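(* Let $P$ be an arbitrary isomorphism-closed class of finite graphs and let $P^\star$ be a class of finite graphs definable by a monadic second-order sentence. Then there is an algorithm that, given an edge gadget $(\mathfrak{g},c,d)$, decides whether the edge gadget reduction $\rho$ given by it is a reduction from $P$ to $P^\star$, i.e. whether for every finite graph $G$: $G\in P$ if and only if $\rho(G)\in P^\star$.
   Context: Graphs are finite, undirected and without self-loops, viewed as structures over the schema consisting of one binary (symmetric) edge relation. Monadic second-order logic extends first-order logic by quantification over sets of elements. An edge gadget is a finite graph $\mathfrak{g}$ with two distinct distinguished nodes $c,d$ such that $\mathfrak{g}$ has an automorphism exchanging $c$ and $d$. The edge gadget reduction $\rho$ given by $(\mathfrak{g},c,d)$ maps a graph $G=(V,E)$ to the graph $\rho(G)$ obtained by keeping all nodes of $V$ and, for every edge $\{u,v\}\in E$, adding a fresh disjoint copy of $\mathfrak{g}$ in which $c$ and $d$ are identified with $u$ and $v$, respectively. *)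

theory Defs
  imports
    "Graph_Theory.Pair_Digraph"
    "Graph_Theory.Digraph_Isomorphism"
    "HOL-Library.Nat_Bijection"
begin

section \<open>Classes of finite graphs\<close>

text \<open>
  A finite, undirected, loop-free graph is a \<^term>\<open>pair_graph\<close>: a finite vertex set with a
  symmetric, irreflexive set of ordered pairs, so that an edge between u and v is present as both
  (u,v) and (v,u).  Every finite graph has an isomorphic copy whose vertices are natural numbers;
  therefore isomorphism-closed classes of finite graphs are given as sets of graphs on naturals.
  The graph without vertices is allowed.
\<close>

type_synonym fgraph = "nat pair_pre_digraph"

definition isomorphism_closed_class :: "fgraph set \<Rightarrow> bool" where
  "isomorphism_closed_class P \<longleftrightarrow>
     (\<forall>G\<in>P. pair_graph G) \<and>
     (\<forall>G\<in>P. \<forall>H. pair_graph H \<and> digraph_iso (with_proj G) (with_proj H) \<longrightarrow> H \<in> P)"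

text \<open>For graphs given by pairs, the library's isomorphism is the usual one.\<close>

lemma digraph_iso_with_proj_iff:
  fixes G :: "'a pair_pre_digraph" and H :: "'b pair_pre_digraph"
  assumes "pair_graph G" "pair_graph H"
  shows "digraph_iso (with_proj G) (with_proj H) \<longleftrightarrow>
    (\<exists>f. bij_betw f (pverts G) (pverts H) \<and>
         (\<forall>u\<in>pverts G. \<forall>v\<in>pverts G. (u, v) \<in> parcs G \<longleftrightarrow> (f u, f v) \<in> parcs H))"
  (is "?L \<longleftrightarrow> ?R")
proof -
  interpret G: pair_graph G by fact
  interpret H: pair_graph H by fact
  show ?thesis
  proof
    assume ?L
    then obtain h where h: "pre_digraph.digraph_isomorphism (with_proj G) h"
      and e: "with_proj H = app_iso h (with_proj G)"
      unfolding digraph_iso_def by blast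
    from e have v: "pverts H = iso_verts h ` pverts G" and a: "parcs H = iso_arcs h ` parcs G"
      and t: "iso_tail h = fst" and d: "iso_head h = snd"
      by (auto simp: with_proj_def app_iso_def)
    from h have i: "inj_on (iso_verts h) (pverts G)"
      and c: "\<And>x. x \<in> parcs G \<Longrightarrow>
        iso_arcs h x = (iso_verts h (fst x), iso_verts h (snd x))"
      unfolding pre_digraph.digraph_isomorphism_def by (auto simp: t d prod_eq_iff)
    have a': "parcs H = (\<lambda>x. (iso_verts h (fst x), iso_verts h (snd x))) ` parcs G"
      unfolding a by (rule image_cong) (auto simp: c)
    have "(u, w) \<in> parcs G"
      if "u \<in> pverts G" "w \<in> pverts G" "(iso_verts h u, iso_verts h w) \<in> parcs H" for u w
    proof -
      from that(3) obtain x y where xy: "(x, y) \<in> parcs G" "iso_verts h u = iso_verts h x"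
        "iso_verts h w = iso_verts h y" unfolding a' by auto
      with G.in_arcsD1 G.in_arcsD2 i that show ?thesis by (metis inj_onD)
    qed
    moreover have "(iso_verts h u, iso_verts h w) \<in> parcs H" if "(u, w) \<in> parcs G" for u w
      using that unfolding a' by force
    ultimately show ?R
      using i v by (intro exI[of _ "iso_verts h"]) (auto simp: bij_betw_def)
  next
    assume ?R
    then obtain f where b: "bij_betw f (pverts G) (pverts H)"
      and f: "\<And>u v. u \<in> pverts G \<Longrightarrow> v \<in> pverts G \<Longrightarrow>
        (u, v) \<in> parcs G \<longleftrightarrow> (f u, f v) \<in> parcs H" by blast
    let ?h = "\<lparr>iso_verts = f, iso_arcs = map_prod f f, iso_head = snd, iso_tail = fst\<rparr>"
    from b have i: "inj_on f (pverts G)" and im: "f ` pverts G = pverts H"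
      by (auto simp: bij_betw_def)
    have "inj_on (map_prod f f) (parcs G)"
      by (rule inj_on_subset[OF map_prod_inj_on[OF i i]])
        (auto dest: G.in_arcsD1 G.in_arcsD2)
    then have "pre_digraph.digraph_isomorphism (with_proj G) ?h"
      unfolding pre_digraph.digraph_isomorphism_def using i G.wf_digraph_axioms by auto
    moreover have "parcs H = map_prod f f ` parcs G"
    proof (intro set_eqI iffI)
      fix e assume e: "e \<in> parcs H"
      obtain x y where xy: "e = (x, y)" by (cases e)
      have "x \<in> f ` pverts G" "y \<in> f ` pverts G"
        using e H.in_arcsD1[of x y] H.in_arcsD2[of x y] unfolding xy im by simp_all
      then obtain u v where uv: "u \<in> pverts G" "v \<in> pverts G" "x = f u" "y = f v" by blast
      with f[of u v] e xy have "(u, v) \<in> parcs G" by simp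
      with uv xy show "e \<in> map_prod f f ` parcs G" by (intro image_eqI[of _ _ "(u, v)"]) simp_all
    next
      fix e assume "e \<in> map_prod f f ` parcs G"
      then obtain u v where "(u, v) \<in> parcs G" "e = (f u, f v)" by auto
      with f[of u v] G.in_arcsD1[of u v] G.in_arcsD2[of u v] show "e \<in> parcs H" by simp
    qed
    then have "with_proj H = app_iso ?h (with_proj G)"
      using im by (simp add: with_proj_def app_iso_def)
    ultimately show ?L unfolding digraph_iso_def by blast
  qed
qed


section \<open>Monadic second-order logic on graphs\<close>

text \<open>Element variables and set variables are two separate copies of the naturals.\<close>

datatype mso =
    Eq nat nat
  | Edge nat nat
  | Mem nat nat  \<comment> \<open>element variable, set variable\<close>
  | Neg mso
  | Conj mso mso
  | Ex_elem nat mso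
  | Ex_set nat mso

fun mso_sat :: "'a pair_pre_digraph \<Rightarrow> (nat \<Rightarrow> 'a) \<Rightarrow> (nat \<Rightarrow> 'a set) \<Rightarrow> mso \<Rightarrow> bool" where
  "mso_sat G e s (Eq x y) \<longleftrightarrow> e x = e y"
| "mso_sat G e s (Edge x y) \<longleftrightarrow> (e x, e y) \<in> parcs G"
| "mso_sat G e s (Mem x X) \<longleftrightarrow> e x \<in> s X"
| "mso_sat G e s (Neg \<phi>) \<longleftrightarrow> \<not> mso_sat G e s \<phi>"
| "mso_sat G e s (Conj \<phi> \<psi>) \<longleftrightarrow> mso_sat G e s \<phi> \<and> mso_sat G e s \<psi>"
| "mso_sat G e s (Ex_elem x \<phi>) \<longleftrightarrow> (\<exists>a\<in>pverts G. mso_sat G (e(x := a)) s \<phi>)"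
| "mso_sat G e s (Ex_set X \<phi>) \<longleftrightarrow> (\<exists>A. A \<subseteq> pverts G \<and> mso_sat G e (s(X := A)) \<phi>)"

fun free_elem_vars :: "mso \<Rightarrow> nat set" where
  "free_elem_vars (Eq x y) = {x, y}"
| "free_elem_vars (Edge x y) = {x, y}"
| "free_elem_vars (Mem x X) = {x}"
| "free_elem_vars (Neg \<phi>) = free_elem_vars \<phi>"
| "free_elem_vars (Conj \<phi> \<psi>) = free_elem_vars \<phi> \<union> free_elem_vars \<psi>"
| "free_elem_vars (Ex_elem x \<phi>) = free_elem_vars \<phi> - {x}"
| "free_elem_vars (Ex_set X \<phi>) = free_elem_vars \<phi>"

fun free_set_vars :: "mso \<Rightarrow> nat set" where
  "free_set_vars (Eq x y) = {}"
| "free_set_vars (Edge x y) = {}"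
| "free_set_vars (Mem x X) = {X}"
| "free_set_vars (Neg \<phi>) = free_set_vars \<phi>"
| "free_set_vars (Conj \<phi> \<psi>) = free_set_vars \<phi> \<union> free_set_vars \<psi>"
| "free_set_vars (Ex_elem x \<phi>) = free_set_vars \<phi>"
| "free_set_vars (Ex_set X \<phi>) = free_set_vars \<phi> - {X}"

definition mso_sentence :: "mso \<Rightarrow> bool" where
  "mso_sentence \<phi> \<longleftrightarrow> free_elem_vars \<phi> = {} \<and> free_set_vars \<phi> = {}"

lemma mso_sat_cong:
  assumes "\<And>x. x \<in> free_elem_vars \<phi> \<Longrightarrow> e x = e' x"
    and "\<And>X. X \<in> free_set_vars \<phi> \<Longrightarrow> s X = s' X"
  shows "mso_sat G e s \<phi> \<longleftrightarrow> mso_sat G e' s' \<phi>"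
  using assms
proof (induction \<phi> arbitrary: e e' s s')
  case (Conj \<phi> \<psi>)
  show ?case using Conj.IH[of e e' s s'] Conj.prems by simp
next
  case (Ex_elem x \<phi>)
  have "mso_sat G (e(x := a)) s \<phi> = mso_sat G (e'(x := a)) s' \<phi>" for a
    by (rule Ex_elem.IH) (use Ex_elem.prems in auto)
  then show ?case by simp
next
  case (Ex_set X \<phi>)
  have "mso_sat G e (s(X := A)) \<phi> = mso_sat G e' (s'(X := A)) \<phi>" for A
    by (rule Ex_set.IH) (use Ex_set.prems in auto)
  then show ?case by simp
next
  case (Neg \<phi>)
  show ?case using Neg.IH[of e e' s s'] Neg.prems by simp
qed auto

text \<open>
  The truth value of a sentence does not depend on the assignments (previous lemma), so it
  is immaterial that the quantification below covers all of them, even ones leaving the graph.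
\<close>

definition mso_models :: "'a pair_pre_digraph \<Rightarrow> mso \<Rightarrow> bool" where
  "mso_models G \<phi> \<longleftrightarrow> (\<forall>e s. mso_sat G e s \<phi>)"

definition mso_definable :: "fgraph set \<Rightarrow> bool" where
  "mso_definable Q \<longleftrightarrow> (\<exists>\<phi>. mso_sentence \<phi> \<and> Q = {G. pair_graph G \<and> mso_models G \<phi>})"


section \<open>Edge gadgets and edge gadget reductions\<close>

type_synonym gadget = "fgraph \<times> nat \<times> nat"

fun edge_gadget :: "gadget \<Rightarrow> bool" where
  "edge_gadget (g, c, d) \<longleftrightarrow>
     pair_graph g \<and> c \<in> pverts g \<and> d \<in> pverts g \<and> c \<noteq> d \<and>
     (\<exists>h. pre_digraph.digraph_isomorphism (with_proj g) h \<and>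
          app_iso h (with_proj g) = with_proj g \<and>
          iso_verts h c = d \<and> iso_verts h d = c)"

text \<open>
  \<^term>\<open>gadget_copy G (g, c, d) u v\<close> names the nodes of the copy of g that is inserted for the edge
  between u and v: c becomes u, d becomes v, and every other node w becomes a number that exceeds
  all vertices of G and determines u, v and w.
\<close>

fun gadget_copy :: "fgraph \<Rightarrow> gadget \<Rightarrow> nat \<Rightarrow> nat \<Rightarrow> nat \<Rightarrow> nat" where
  "gadget_copy G (g, c, d) u v w =
     (if w = c then u else if w = d then v
      else Suc (Max (insert 0 (pverts G))) + prod_encode (prod_encode (u, v), w))"

text \<open>
  The condition u < v selects one of the two ordered pairs that represent an edge, so that each
  edge receives exactly one copy.  It also fixes which endpoint is identified with c; because of
  the automorphism exchanging c and d, the other choice gives an isomorphic graph.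
\<close>

fun edge_gadget_reduction :: "gadget \<Rightarrow> fgraph \<Rightarrow> fgraph" where
  "edge_gadget_reduction (g, c, d) G =
     \<lparr> pverts = pverts G \<union>
         {gadget_copy G (g, c, d) u v w | u v w. (u, v) \<in> parcs G \<and> u < v \<and> w \<in> pverts g},
       parcs =
         {(gadget_copy G (g, c, d) u v x, gadget_copy G (g, c, d) u v y) | u v x y.
            (u, v) \<in> parcs G \<and> u < v \<and> (x, y) \<in> parcs g} \<rparr>"

definition is_reduction :: "(fgraph \<Rightarrow> fgraph) \<Rightarrow> fgraph set \<Rightarrow> fgraph set \<Rightarrow> bool" where
  "is_reduction \<rho> P Q \<longleftrightarrow> (\<forall>G. pair_graph G \<longrightarrow> (G \<in> P \<longleftrightarrow> \<rho> G \<in> Q))"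

lemma gadget_copy_gt:
  assumes "finite (pverts G)" "z \<in> pverts G" "w \<noteq> c" "w \<noteq> d"
  shows "z < gadget_copy G (g, c, d) u v w"
proof -
  have "z \<le> Max (insert 0 (pverts G))" using assms by (intro Max_ge) auto
  then have "z < Suc (Max (insert 0 (pverts G))) + k" for k by linarith
  then show ?thesis using assms by (simp only: gadget_copy.simps if_False)
qed

lemma gadget_copy_inj:
  assumes "finite (pverts G)" "u \<in> pverts G" "v \<in> pverts G" "u \<noteq> v"
  shows "inj (gadget_copy G (g, c, d) u v)"
proof (rule injI)
  fix x y assume e: "gadget_copy G (g, c, d) u v x = gadget_copy G (g, c, d) u v y"
  have gt: "u < gadget_copy G (g, c, d) u v w" "v < gadget_copy G (g, c, d) u v w"
    if "w \<noteq> c" "w \<noteq> d" for w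
    using that assms by (auto intro: gadget_copy_gt simp del: gadget_copy.simps)
  show "x = y"
  proof (cases "x \<in> {c, d} \<or> y \<in> {c, d}")
    case True
    then show ?thesis using e gt[of x] gt[of y] \<open>u \<noteq> v\<close> by (auto split: if_splits)
  next
    case False
    then show ?thesis using e by simp
  qed
qed

lemma pair_graph_edge_gadget_reduction:
  assumes "edge_gadget (g, c, d)" "pair_graph G"
  shows "pair_graph (edge_gadget_reduction (g, c, d) G)"
proof -
  interpret g: pair_graph g using assms by simp
  interpret G: pair_graph G by fact
  let ?f = "gadget_copy G (g, c, d)"
  let ?H = "edge_gadget_reduction (g, c, d) G"
  have in_V: "?f u v w \<in> pverts ?H" if "(u, v) \<in> parcs G" "u < v" "w \<in> pverts g" for u v w
    using that by (auto simp del: gadget_copy.simps)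
  have arcE: "\<exists>u v x y. (u, v) \<in> parcs G \<and> u < v \<and> (x, y) \<in> parcs g \<and> a = ?f u v x \<and> b = ?f u v y"
    if "(a, b) \<in> parcs ?H" for a b
    using that by (auto simp del: gadget_copy.simps)
  have arcI: "(?f u v x, ?f u v y) \<in> parcs ?H"
    if "(u, v) \<in> parcs G" "u < v" "(x, y) \<in> parcs g" for u v x y
    using that by (auto simp del: gadget_copy.simps)
  have "pverts ?H \<subseteq> pverts G \<union> (\<lambda>(e, w). ?f (fst e) (snd e) w) ` (parcs G \<times> pverts g)"
    by (force simp del: gadget_copy.simps)
  then have fin: "finite (pverts ?H)"
    by (rule finite_subset)
      (intro finite_UnI finite_imageI finite_cartesian_product G.pair_finite_verts
        G.pair_finite_arcs g.pair_finite_verts)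
  have sub: "a \<in> pverts ?H \<and> b \<in> pverts ?H" if "(a, b) \<in> parcs ?H" for a b
  proof -
    from arcE[OF that] obtain u v x y where *: "(u, v) \<in> parcs G" "u < v" "(x, y) \<in> parcs g"
      "a = ?f u v x" "b = ?f u v y" by blast
    show ?thesis
      unfolding *(4,5) using in_V[OF *(1,2)] g.in_arcsD1[OF *(3)] g.in_arcsD2[OF *(3)] by blast
  qed
  have "parcs ?H \<subseteq> pverts ?H \<times> pverts ?H" using sub by (intro subrelI) blast
  then have fin': "finite (parcs ?H)" 
    by (rule finite_subset) (intro finite_cartesian_product fin)
  have "sym (parcs g)" using g.pair_sym_arcs by (simp add: symmetric_def)
  have sym: "sym (parcs ?H)"
  proof (rule symI)
    fix a b assume "(a, b) \<in> parcs ?H"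
    from arcE[OF this] obtain u v x y where *: "(u, v) \<in> parcs G" "u < v" "(x, y) \<in> parcs g"
      "a = ?f u v x" "b = ?f u v y" by blast
    have "(y, x) \<in> parcs g" using \<open>sym (parcs g)\<close> *(3) by (rule symD)
    then show "(b, a) \<in> parcs ?H" unfolding * using arcI *(1,2) by blast
  qed
  have irr: "a \<noteq> b" if ab: "(a, b) \<in> parcs ?H" for a b
  proof -
    from arcE[OF ab] obtain u v x y where *: "(u, v) \<in> parcs G" "u < v" "(x, y) \<in> parcs g"
      "a = ?f u v x" "b = ?f u v y" by blast
    have "inj (?f u v)"
      using * G.in_arcsD1 G.in_arcsD2 G.pair_finite_verts by (intro gadget_copy_inj) auto
    moreover have "x \<noteq> y" using g.pair_no_loops[OF *(3)] by simp
    ultimately show ?thesis unfolding *(4,5) by (auto dest: injD simp del: gadget_copy.simps)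
  qed
  show ?thesis
  proof (unfold_locales, goal_cases)
    case (1 e) then show ?case using sub[of "fst e" "snd e"] by simp
  next
    case (2 e) then show ?case using sub[of "fst e" "snd e"] by simp
  next
    case 3 show ?case by (rule fin)
  next
    case 4 show ?case by (rule fin')
  next
    case (5 e) then show ?case using irr[of "fst e" "snd e"] by simp
  next
    case 6 show ?case using sym by (simp add: symmetric_def del: edge_gadget_reduction.simps)
  qed
qed


section \<open>Decidability\<close>

text \<open>
  The total recursive functions: the least class that contains the zero, successor and projection
  functions and is closed under composition, primitive recursion and minimisation of regular
  functions.  \<^term>\<open>recursive n f\<close> says that f, restricted to argument lists of length n, is an n-ary
  recursive function; on lists of other lengths f is irrelevant.
\<close>

inductive recursive :: "nat \<Rightarrow> (nat list \<Rightarrow> nat) \<Rightarrow> bool" where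
  zero: "recursive n (\<lambda>xs. 0)"
| suc: "recursive 1 (\<lambda>xs. Suc (hd xs))"
| proj: "i < n \<Longrightarrow> recursive n (\<lambda>xs. xs ! i)"
| comp: "recursive m g \<Longrightarrow> length fs = m \<Longrightarrow> \<forall>f\<in>set fs. recursive n f \<Longrightarrow>
    recursive n (\<lambda>xs. g (map (\<lambda>f. f xs) fs))"
| prim_rec: "recursive n f \<Longrightarrow> recursive (Suc (Suc n)) g \<Longrightarrow>
    recursive (Suc n) (\<lambda>xs. rec_nat (f (tl xs)) (\<lambda>k r. g (k # r # tl xs)) (hd xs))"
| minimisation: "recursive (Suc n) f \<Longrightarrow> \<forall>xs. length xs = n \<longrightarrow> (\<exists>k. f (k # xs) = 0) \<Longrightarrow>
    recursive n (\<lambda>xs. LEAST k. f (k # xs) = 0)"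

text \<open>
  The property Q is decidable for inputs that satisfy I and are presented to the algorithm through
  the encoding enc.
\<close>

definition decidable_for :: "('a \<Rightarrow> nat) \<Rightarrow> ('a \<Rightarrow> bool) \<Rightarrow> ('a \<Rightarrow> bool) \<Rightarrow> bool" where
  "decidable_for enc I Q \<longleftrightarrow>
     (\<exists>f. recursive 1 f \<and> (\<forall>x. I x \<longrightarrow> f [enc x] = (if Q x then 1 else 0)))"

text \<open>
  Gadgets are encoded explicitly: a finite set of numbers by the number with the corresponding
  binary digits, and pairs by the Cantor pairing function.
\<close>

fun gadget_code :: "gadget \<Rightarrow> nat" where
  "gadget_code (g, c, d) =
     prod_encode (prod_encode (set_encode (pverts g), set_encode (prod_encode ` parcs g)),
                  prod_encode (c, d))"

lemma inj_on_gadget_code: "inj_on gadget_code {\<gamma>. edge_gadget \<gamma>}"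
proof (rule inj_onI)
  fix \<gamma> \<delta> assume *: "\<gamma> \<in> {\<gamma>. edge_gadget \<gamma>}" "\<delta> \<in> {\<gamma>. edge_gadget \<gamma>}"
    "gadget_code \<gamma> = gadget_code \<delta>"
  obtain g c d g' c' d' where [simp]: "\<gamma> = (g, c, d)" "\<delta> = (g', c', d')" by (metis prod.exhaust)
  interpret g: pair_graph g using * by simp
  interpret g': pair_graph g' using * by simp
  have "pverts g = pverts g'" "prod_encode ` parcs g = prod_encode ` parcs g'" "c = c'" "d = d'"
    using *(3) g.pair_finite_verts g'.pair_finite_verts g.pair_finite_arcs g'.pair_finite_arcs
    by (auto simp: set_encode_eq)
  then show "\<gamma> = \<delta>" by (simp add: inj_image_eq_iff[OF inj_prod_encode])
qed

end

theory Submission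
  imports Defs
begin

text \<open>
  A set of vertices of the reduction of G splits into a set of vertices of G and one trace, a set of
  gadget nodes, for each edge of G.  In the Ehrenfeucht--Fraisse game for monadic second-order
  logic, Duplicator therefore wins between the reductions of G under two gadgets if she wins the
  corresponding game on the gadgets themselves: she answers within each copy separately and keeps
  the part in G.  So whether a gadget yields a reduction from P to Pstar depends only on its
  monadic second-order type up to a fixed quantifier depth.  There are finitely many such types
  and each is recognised by a recursive function, so a finite table, depending on P, of the
  types that yield a reduction decides the question.
\<close>

section \<open>Recursive functions and predicates\<close>

text \<open>P may be undecidable; nothing about it is computed. The table is a finite object built
  into the recursive function, and only its existence is shown. Two obstacles shape the game. Copies
  share the vertices of G, so answers found separately in each copy must agree on every shared
  vertex; membership of the two ends is an atomic property for this reason. And an element variable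
  must remain one element although Duplicator answers with sets, while being a singleton cannot be
  read from one copy, as a vertex of G shows in the copy at each of its edges. Types are not
  expressed by formulas: \<open>moves\<close> collects one property per truth pattern of the level
  before, which yields finiteness, decidability and Duplicator's answer from one definition.\<close>

text \<open>\<^const>\<open>recursive\<close> is not closed under changing a function on argument lists of the wrong
  length, hence the closure under agreement on lists of length n.\<close>

definition recf :: "nat \<Rightarrow> (nat list \<Rightarrow> nat) \<Rightarrow> bool" where
  "recf n F \<longleftrightarrow> (\<exists>f. recursive n f \<and> (\<forall>xs. length xs = n \<longrightarrow> f xs = F xs))"

definition dec :: "nat \<Rightarrow> (nat list \<Rightarrow> bool) \<Rightarrow> bool" where
  "dec n P \<longleftrightarrow> recf n (\<lambda>xs. of_bool (P xs))"

section \<open>Closure under substitution, recursion, bounded quantifiers and minimisation\<close>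

lemma recf_cong: "recf n F \<Longrightarrow> (\<And>xs. length xs = n \<Longrightarrow> F xs = G xs) \<Longrightarrow> recf n G"
  unfolding recf_def by metis

lemma dec_cong: "dec n P \<Longrightarrow> (\<And>xs. length xs = n \<Longrightarrow> P xs = Q xs) \<Longrightarrow> dec n Q"
  unfolding dec_def by (erule recf_cong) simp

lemma recf_zero: "recf n (\<lambda>_. 0)"
  unfolding recf_def using recursive.zero by blast

lemma recf_nth: "i < n \<Longrightarrow> recf n (\<lambda>xs. xs ! i)"
  unfolding recf_def using recursive.proj by blast

lemma recf_comp:
  assumes "recf m g" "length fs = m" "\<And>f. f \<in> set fs \<Longrightarrow> recf n f"
  shows "recf n (\<lambda>xs. g (map (\<lambda>f. f xs) fs))"
proof -
  obtain g' where g': "recursive m g'" "\<And>xs. length xs = m \<Longrightarrow> g' xs = g xs"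
    using assms(1) unfolding recf_def by blast
  obtain h where h: "\<And>f. f \<in> set fs \<Longrightarrow> recursive n (h f) \<and> (\<forall>xs. length xs = n \<longrightarrow> h f xs = f xs)"
    using assms(3) unfolding recf_def by metis
  have "recursive n (\<lambda>xs. g' (map (\<lambda>f. f xs) (map h fs)))"
    by (rule recursive.comp[OF g'(1)]) (use assms h in auto)
  moreover have "g' (map (\<lambda>f. f xs) (map h fs)) = g (map (\<lambda>f. f xs) fs)" if "length xs = n" for xs
  proof -
    have "map (\<lambda>f. f xs) (map h fs) = map (\<lambda>f. f xs) fs" using h that by simp
    then show ?thesis using g'(2)[of "map (\<lambda>f. f xs) fs"] assms(2) by (simp only: length_map)
  qed
  ultimately show ?thesis unfolding recf_def by blast
qed

text \<open>Composition with the inner functions indexed by position: arguments can be reordered,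
  dropped or duplicated, and the arity changed.\<close>

lemma recf_subst:
  assumes "recf m F" "\<And>j. j < m \<Longrightarrow> recf n (h j)"
  shows "recf n (\<lambda>xs. F (map (\<lambda>j. h j xs) [0..<m]))"
proof -
  have "recf n (\<lambda>xs. F (map (\<lambda>f. f xs) (map h [0..<m])))"
    by (rule recf_comp[OF assms(1)]) (use assms(2) in auto)
  then show ?thesis by (simp add: comp_def)
qed

lemma dec_subst:
  "dec m P \<Longrightarrow> (\<And>j. j < m \<Longrightarrow> recf n (h j)) \<Longrightarrow> dec n (\<lambda>xs. P (map (\<lambda>j. h j xs) [0..<m]))"
  unfolding dec_def by (rule recf_subst)

lemma recf_hd: "recf (Suc n) hd"
  by (rule recf_cong[OF recf_nth[of 0]]) (auto simp: length_Suc_conv)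

lemma recf_tl: "recf n a \<Longrightarrow> recf (Suc n) (\<lambda>xs. a (tl xs))"
  by (rule recf_cong[OF recf_subst[of n a "Suc n" "\<lambda>j xs. xs ! Suc j"]])
    (auto intro!: recf_nth arg_cong[of _ _ a] nth_equalityI simp: nth_tl)

lemma recf_Suc: assumes "recf n a" shows "recf n (\<lambda>xs. Suc (a xs))"
proof -
  have "recf 1 (\<lambda>xs. Suc (hd xs))" unfolding recf_def using recursive.suc by blast
  from recf_comp[OF this, of "[a]" n] assms show ?thesis by simp
qed

lemma recf_const: "recf n (\<lambda>_. k)"
  by (induction k) (auto intro: recf_zero recf_Suc)

text \<open>Primitive recursion on the first argument, with b and the projections substituted for
  the arguments. Writing the step with \<open>hd\<close> and \<open>tl\<close> lets
  \<open>recf_hd\<close> and \<open>recf_tl\<close> close the goals that arise for a concrete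
  g.\<close>

lemma recf_rec_nat:
  assumes "recf n a" "recf n b" "recf (Suc (Suc n)) (\<lambda>ys. g (hd ys) (hd (tl ys)) (tl (tl ys)))"
  shows "recf n (\<lambda>xs. rec_nat (a xs) (\<lambda>k r. g k r xs) (b xs))"
proof -
  let ?g = "\<lambda>ys. g (hd ys) (hd (tl ys)) (tl (tl ys))"
  obtain a' where a': "recursive n a'" "\<And>xs. length xs = n \<Longrightarrow> a' xs = a xs"
    using assms(1) unfolding recf_def by blast
  obtain g' where g': "recursive (Suc (Suc n)) g'" "\<And>xs. length xs = Suc (Suc n) \<Longrightarrow> g' xs = ?g xs"
    using assms(3) unfolding recf_def by blast
  let ?r = "\<lambda>xs. rec_nat (a' (tl xs)) (\<lambda>k r. g' (k # r # tl xs)) (hd xs)"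
  have "recf (Suc n) ?r"
    using recursive.prim_rec[OF a'(1) g'(1)] unfolding recf_def by blast
  then have "recf n (\<lambda>xs. ?r (map (\<lambda>f. f xs) (b # map (\<lambda>i xs. xs ! i) [0..<n])))"
    by (rule recf_comp) (auto intro: assms(2) recf_nth)
  then show ?thesis
  proof (rule recf_cong)
    fix xs :: "nat list" assume l: "length xs = n"
    then have "map (\<lambda>i. xs ! i) [0..<n] = xs" by (metis map_nth)
    then show "?r (map (\<lambda>f. f xs) (b # map (\<lambda>i xs. xs ! i) [0..<n])) =
        rec_nat (a xs) (\<lambda>k r. g k r xs) (b xs)"
      using l by (simp add: comp_def a' g')
  qed
qed

lemma recf_add: assumes "recf n a" "recf n b" shows "recf n (\<lambda>xs. a xs + b xs)"
proof -
  have "recf n (\<lambda>xs. rec_nat (a xs) (\<lambda>k r. Suc r) (b xs))"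
    by (intro recf_rec_nat assms recf_Suc recf_tl recf_hd)
  moreover have "rec_nat x (\<lambda>k r. Suc r) y = x + y" for x y :: nat by (induction y) auto
  ultimately show ?thesis by simp
qed

lemma recf_mult: assumes "recf n a" "recf n b" shows "recf n (\<lambda>xs. a xs * b xs)"
proof -
  have "recf n (\<lambda>xs. rec_nat 0 (\<lambda>k r. r + a xs) (b xs))"
    by (intro recf_rec_nat assms recf_add recf_tl recf_hd recf_const)
  moreover have "rec_nat 0 (\<lambda>k r. r + x) y = x * y" for x y :: nat by (induction y) auto
  ultimately show ?thesis by simp
qed

lemma recf_diff: assumes "recf n a" "recf n b" shows "recf n (\<lambda>xs. a xs - b xs)"
proof -
  have p: "rec_nat 0 (\<lambda>k r. k) y = y - 1" for y :: nat by (cases y) auto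
  have pred: "recf m (\<lambda>xs. c xs - 1)" if "recf m c" for m c
  proof -
    have "recf m (\<lambda>xs. rec_nat 0 (\<lambda>k r. k) (c xs))"
      by (intro recf_rec_nat that recf_hd recf_const)
    then show ?thesis unfolding p .
  qed
  have "recf n (\<lambda>xs. rec_nat (a xs) (\<lambda>k r. r - 1) (b xs))"
    by (intro recf_rec_nat assms pred recf_tl recf_hd)
  moreover have "rec_nat x (\<lambda>k r. r - 1) y = x - y" for x y :: nat by (induction y) auto
  ultimately show ?thesis by simp
qed

lemma recf_power2: assumes "recf n b" shows "recf n (\<lambda>xs. 2 ^ b xs)"
proof -
  have "recf n (\<lambda>xs. rec_nat 1 (\<lambda>k r. r + r) (b xs))"
    by (intro recf_rec_nat assms recf_add recf_tl recf_hd recf_const)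
  moreover have "rec_nat 1 (\<lambda>k r. r + r) y = (2 :: nat) ^ y" for y by (induction y) auto
  ultimately show ?thesis by simp
qed

lemma recf_prod_encode:
  assumes "recf n a" "recf n b" shows "recf n (\<lambda>xs. prod_encode (a xs, b xs))"
proof -
  \<comment> \<open>The recursion adds up 1 + ... + y, the triangular number in Cantor's
    pairing.\<close>
  have "recf n (\<lambda>xs. rec_nat 0 (\<lambda>k r. r + Suc k) (a xs + b xs) + a xs)"
    by (intro recf_rec_nat assms recf_add recf_Suc recf_tl recf_hd recf_const)
  moreover have "rec_nat 0 (\<lambda>k r. r + Suc k) y = triangle y" for y :: nat by (induction y) auto
  ultimately show ?thesis by (simp add: prod_encode_def)
qed

lemma dec_neg: assumes "dec n P" shows "dec n (\<lambda>xs. \<not> P xs)"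
proof -
  have "recf n (\<lambda>xs. 1 - of_bool (P xs))"
    using assms unfolding dec_def by (intro recf_diff recf_const)
  then show ?thesis unfolding dec_def by (rule recf_cong) simp
qed

lemma dec_conj: "dec n P \<Longrightarrow> dec n Q \<Longrightarrow> dec n (\<lambda>xs. P xs \<and> Q xs)"
  unfolding dec_def of_bool_conj by (rule recf_mult)

lemma dec_disj:
  assumes "dec n P" "dec n Q" shows "dec n (\<lambda>xs. P xs \<or> Q xs)"
proof (rule dec_cong)
  show "dec n (\<lambda>xs. \<not> (\<not> P xs \<and> \<not> Q xs))" by (intro dec_neg dec_conj assms)
qed blast

lemma dec_imp:
  assumes "dec n P" "dec n Q" shows "dec n (\<lambda>xs. P xs \<longrightarrow> Q xs)"
proof (rule dec_cong)
  show "dec n (\<lambda>xs. \<not> (P xs \<and> \<not> Q xs))" by (intro dec_neg dec_conj assms)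
qed blast

lemma dec_const: "dec n (\<lambda>_. b)"
  unfolding dec_def by (rule recf_const)

lemma dec_iff_const: "dec n P \<Longrightarrow> dec n (\<lambda>xs. b \<longleftrightarrow> P xs)"
  by (cases b) (simp_all add: dec_neg)

text \<open>S is fixed and not an input: the quantifier is a finite conjunction, so S may consist of
  objects without a code, such as properties of gadgets.\<close>

lemma dec_Ball_finite:
  assumes "finite S" "\<And>x. x \<in> S \<Longrightarrow> dec n (P x)"
  shows "dec n (\<lambda>xs. \<forall>x\<in>S. P x xs)"
  using assms
proof (induction S rule: finite_induct)
  case (insert x S)
  have "dec n (\<lambda>xs. P x xs \<and> (\<forall>x\<in>S. P x xs))" by (rule dec_conj) (simp_all add: insert)
  then show ?case by simp
qed (simp add: dec_const)

lemma dec_Bex_finite: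
  assumes "finite S" "\<And>x. x \<in> S \<Longrightarrow> dec n (P x)"
  shows "dec n (\<lambda>xs. \<exists>x\<in>S. P x xs)"
proof -
  have "dec n (\<lambda>xs. \<not> (\<forall>x\<in>S. \<not> P x xs))"
    by (intro dec_neg dec_Ball_finite assms)
  then show ?thesis by simp
qed

lemma dec_le:
  assumes "recf n a" "recf n b" shows "dec n (\<lambda>xs. a xs \<le> b xs)"
proof -
  have "recf n (\<lambda>xs. 1 - (a xs - b xs))"
    by (intro recf_diff recf_const assms)
  then show ?thesis unfolding dec_def by (rule recf_cong) simp
qed

lemma dec_less: "recf n a \<Longrightarrow> recf n b \<Longrightarrow> dec n (\<lambda>xs. a xs < b xs)"
  using dec_le[OF recf_Suc, of n a b] by (simp add: less_eq_Suc_le)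

lemma dec_eq: "recf n a \<Longrightarrow> recf n b \<Longrightarrow> dec n (\<lambda>xs. a xs = b xs)"
  using dec_conj[OF dec_le dec_le, of n a b b a] by (simp add: order_eq_iff[symmetric])

lemma dec_Ex_less:
  assumes "dec (Suc n) (\<lambda>ys. Q (hd ys) (tl ys))" "recf n b"
  shows "dec n (\<lambda>xs. \<exists>k<b xs. Q k xs)"
proof -
  \<comment> \<open>The step of the recursion below also receives the value accumulated so far; here
    it becomes an ignored second argument.\<close>
  have "dec (Suc (Suc n)) (\<lambda>ys. Q (hd ys) (tl (tl ys)))"
    by (rule dec_cong[OF dec_subst[OF assms(1), where
            h = "\<lambda>j. case j of 0 \<Rightarrow> hd | Suc i \<Rightarrow> (\<lambda>ys. ys ! Suc j)"]])
      (auto intro!: recf_nth recf_hd arg_cong2[of _ _ _ _ Q] nth_equalityI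
        split: nat.splits simp: hd_map nth_tl map_tl simp del: upt_Suc)
  then have "dec (Suc (Suc n)) (\<lambda>ys. 0 < hd (tl ys) \<or> Q (hd ys) (tl (tl ys)))"
    by (intro dec_disj dec_less recf_const recf_tl recf_hd)
  then have "recf n (\<lambda>xs. rec_nat 0 (\<lambda>k r. of_bool (0 < r \<or> Q k xs)) (b xs))"
    unfolding dec_def by (intro recf_rec_nat recf_const assms(2))
  moreover have "rec_nat 0 (\<lambda>k r. of_bool (0 < r \<or> Q k xs)) m = (of_bool (\<exists>k<m. Q k xs) :: nat)" for xs m
    by (induction m) (auto simp: less_Suc_eq)
  ultimately show ?thesis unfolding dec_def by simp
qed

lemma dec_All_less:
  assumes "dec (Suc n) (\<lambda>ys. Q (hd ys) (tl ys))" "recf n b"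
  shows "dec n (\<lambda>xs. \<forall>k<b xs. Q k xs)"
  using dec_neg[OF dec_Ex_less[OF dec_neg[OF assms(1)] assms(2)]] by simp

text \<open>Minimisation looks for a zero, so it is applied to the characteristic function of the
  negation of Q; the second premise supplies regularity.\<close>

lemma recf_Least:
  assumes "dec (Suc n) (\<lambda>ys. Q (hd ys) (tl ys))" "\<And>xs. length xs = n \<Longrightarrow> \<exists>k. Q k xs"
  shows "recf n (\<lambda>xs. LEAST k. Q k xs)"
proof -
  obtain f where f: "recursive (Suc n) f"
    "\<And>ys. length ys = Suc n \<Longrightarrow> f ys = of_bool (\<not> Q (hd ys) (tl ys))"
    using dec_neg[OF assms(1)] unfolding dec_def recf_def by blast
  have "recursive n (\<lambda>xs. LEAST k. f (k # xs) = 0)"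
    using assms(2) by (intro recursive.minimisation f) (auto simp: f)
  then show ?thesis unfolding recf_def using f(2) by (intro exI conjI) auto
qed

lemmas recf_intros = recf_const recf_Suc recf_add recf_mult recf_diff recf_power2 recf_prod_encode
  recf_tl recf_hd
lemmas dec_intros = dec_neg dec_conj dec_imp dec_le dec_less dec_eq dec_Ex_less dec_All_less

section \<open>Decoding of pairs and finite sets\<close>

lemma recf_fst_prod_decode: assumes "recf n a" shows "recf n (\<lambda>xs. fst (prod_decode (a xs)))"
proof -
  have eq: "(\<exists>l<Suc z. prod_encode (k, l) = z) \<longleftrightarrow> k = fst (prod_decode z)" for k z
  proof -
    obtain x y where "z = prod_encode (x, y)" by (metis prod_decode_inverse surj_pair)
    then show ?thesis using le_prod_encode_2[where a = x and b = y] by (auto simp: less_Suc_eq_le)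
  qed
  \<comment> \<open>A component of a pair is at most the code of the pair, which bounds l; the k
    found is the only solution, hence the least.\<close>
  have "recf n (\<lambda>xs. LEAST k. \<exists>l<Suc (a xs). prod_encode (k, l) = a xs)"
    by (intro recf_Least dec_intros recf_intros assms) (simp only: eq, blast)
  then show ?thesis unfolding eq by (simp add: Least_equality)
qed

lemma recf_snd_prod_decode: assumes "recf n a" shows "recf n (\<lambda>xs. snd (prod_decode (a xs)))"
proof -
  have eq: "(\<exists>l<Suc z. prod_encode (l, k) = z) \<longleftrightarrow> k = snd (prod_decode z)" for k z
  proof -
    obtain x y where "z = prod_encode (x, y)" by (metis prod_decode_inverse surj_pair)
    then show ?thesis using le_prod_encode_1[where a = x and b = y] by (auto simp: less_Suc_eq_le)
  qed
  have "recf n (\<lambda>xs. LEAST k. \<exists>l<Suc (a xs). prod_encode (l, k) = a xs)"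
    by (intro recf_Least dec_intros recf_intros assms) (simp only: eq, blast)
  then show ?thesis unfolding eq by (simp add: Least_equality)
qed

lemma dec_mem_set_decode:
  assumes "recf n a" "recf n b" shows "dec n (\<lambda>xs. a xs \<in> set_decode (b xs))"
proof -
  \<comment> \<open>Bit k of m is 1 iff the quotient of m by 2^k is odd. Division is replaced by a
    search for q and the remainder r, both at most m.\<close>
  have eq: "k \<in> set_decode m \<longleftrightarrow>
      (\<exists>q<Suc m. \<exists>r<Suc m. r < 2 ^ k \<and> m = Suc (2 * q) * 2 ^ k + r)" for k m
  proof
    assume "k \<in> set_decode m"
    then have "odd (m div 2 ^ k)" by (simp add: set_decode_def)
    then obtain q where q: "m div 2 ^ k = Suc (2 * q)" by (metis oddE Suc_eq_plus1)
    have "m = Suc (2 * q) * 2 ^ k + m mod 2 ^ k" using div_mult_mod_eq[of m "2 ^ k"] q by simp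
    moreover have "m mod 2 ^ k < 2 ^ k" by simp
    moreover have "m mod 2 ^ k < Suc m" by (simp add: le_imp_less_Suc)
    moreover have "q < Suc m" using q div_le_dividend[of m "2 ^ k"] by simp
    ultimately show "\<exists>q<Suc m. \<exists>r<Suc m. r < 2 ^ k \<and> m = Suc (2 * q) * 2 ^ k + r" by blast
  next
    assume "\<exists>q<Suc m. \<exists>r<Suc m. r < 2 ^ k \<and> m = Suc (2 * q) * 2 ^ k + r"
    then obtain q r where "r < 2 ^ k" "m = r + Suc (2 * q) * 2 ^ k" by (metis add.commute)
    then have "m div 2 ^ k = Suc (2 * q)" using div_mult_self1[of "2 ^ k" r "Suc (2 * q)"] by simp
    then show "k \<in> set_decode m" by (simp add: set_decode_def)
  qed
  show ?thesis unfolding eq by (intro dec_intros recf_intros assms)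
qed

text \<open>From k < 2^k \<le> m. It bounds searches over the elements of a coded set.\<close>

lemma set_decode_less: assumes "k \<in> set_decode m" shows "k < m"
proof -
  have "odd (m div 2 ^ k)" using assms by (simp add: set_decode_def)
  then have "0 < m div 2 ^ k" by (rule odd_pos)
  then have "2 ^ k \<le> m" by (simp add: div_greater_zero_iff)
  then show ?thesis using less_exp[of k] by linarith
qed

lemma dec_set_decode_subset:
  assumes "recf n a" "recf n b" shows "dec n (\<lambda>xs. set_decode (a xs) \<subseteq> set_decode (b xs))"
proof -
  have "set_decode x \<subseteq> set_decode y \<longleftrightarrow> (\<forall>k<x. k \<in> set_decode x \<longrightarrow> k \<in> set_decode y)" for x y
    using set_decode_less by blast
  then show ?thesis by (simp only:) (intro dec_intros dec_mem_set_decode recf_intros assms)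
qed

section \<open>Decidable properties of gadgets with sets\<close>

type_synonym gprop = "gadget \<Rightarrow> (nat \<Rightarrow> nat set) \<Rightarrow> bool"

text \<open>Four numbers hold the gadget, so the i-th set sits at position i + 4 and the arity is N
  + 4. Sets with index N or more are invisible.\<close>

definition gargs :: "nat \<Rightarrow> gadget \<Rightarrow> (nat \<Rightarrow> nat set) \<Rightarrow> nat list" where
  "gargs N \<gamma> A = set_encode (pverts (fst \<gamma>)) # set_encode (prod_encode ` parcs (fst \<gamma>)) #
     fst (snd \<gamma>) # snd (snd \<gamma>) # map (\<lambda>i. set_encode (A i)) [0..<N]"

text \<open>The sets are confined to the gadget because \<open>set_encode\<close> is faithful only
  on finite sets.\<close>

definition gdec :: "nat \<Rightarrow> gprop \<Rightarrow> bool" where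
  "gdec N D \<longleftrightarrow> (\<exists>R. dec (N + 4) R \<and>
     (\<forall>\<gamma> A. edge_gadget \<gamma> \<longrightarrow> (\<forall>i. A i \<subseteq> pverts (fst \<gamma>)) \<longrightarrow> (D \<gamma> A \<longleftrightarrow> R (gargs N \<gamma> A))))"

text \<open>The first four kinds keep element variables single, and the two about ends also make
  answers in neighbouring copies compatible. Inclusion covers equality and membership, as elements
  are stored as singletons; the last kind covers \<open>Edge\<close>.\<close>

definition atoms :: "nat \<Rightarrow> gprop set" where
  "atoms N =
     (\<Union>i<N. {\<lambda>\<gamma> A. A i = {}, \<lambda>\<gamma> A. is_singleton (A i),
               \<lambda>\<gamma> A. fst (snd \<gamma>) \<in> A i, \<lambda>\<gamma> A. snd (snd \<gamma>) \<in> A i}) \<union>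
     (\<Union>i<N. \<Union>j<N. {\<lambda>\<gamma> A. A i \<subseteq> A j, \<lambda>\<gamma> A. \<exists>x\<in>A i. \<exists>y\<in>A j. (x, y) \<in> parcs (fst \<gamma>)})"

text \<open>The properties in \<^term>\<open>moves F i\<close> tell which patterns of truth values of F can be
  achieved by choosing the i-th set anew: one round of an Ehrenfeucht--Fraisse game.\<close>

definition move :: "gprop set \<Rightarrow> nat \<Rightarrow> gprop set \<Rightarrow> gprop" where
  "move F i S = (\<lambda>\<gamma> A. \<exists>X\<subseteq>pverts (fst \<gamma>). \<forall>D\<in>F. D \<in> S \<longleftrightarrow> D \<gamma> (A(i := X)))"

definition moves :: "gprop set \<Rightarrow> nat \<Rightarrow> gprop set" where
  "moves F i = move F i ` Pow F"

section \<open>Recursive recognition of atoms and of one round of the game\<close>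

lemma length_gargs: "length (gargs N \<gamma> A) = N + 4"
  by (simp add: gargs_def)

lemma nth_gargs:
  "gargs N \<gamma> A ! 0 = set_encode (pverts (fst \<gamma>))"
  "gargs N \<gamma> A ! 1 = set_encode (prod_encode ` parcs (fst \<gamma>))"
  "gargs N \<gamma> A ! 2 = fst (snd \<gamma>)"
  "gargs N \<gamma> A ! 3 = snd (snd \<gamma>)"
  "i < N \<Longrightarrow> gargs N \<gamma> A ! (i + 4) = set_encode (A i)"
  by (simp_all add: gargs_def eval_nat_numeral)

lemma edge_gadgetD:
  assumes "edge_gadget \<gamma>"
  shows "pair_graph (fst \<gamma>)" "finite (pverts (fst \<gamma>))" "finite (parcs (fst \<gamma>))"
    "fst (snd \<gamma>) \<in> pverts (fst \<gamma>)" "snd (snd \<gamma>) \<in> pverts (fst \<gamma>)" "fst (snd \<gamma>) \<noteq> snd (snd \<gamma>)"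
proof -
  obtain g c d where \<gamma>: "\<gamma> = (g, c, d)" by (metis prod.exhaust)
  interpret g: pair_graph g using assms \<gamma> by simp
  show "pair_graph (fst \<gamma>)" "finite (pverts (fst \<gamma>))" "finite (parcs (fst \<gamma>))"
    "fst (snd \<gamma>) \<in> pverts (fst \<gamma>)" "snd (snd \<gamma>) \<in> pverts (fst \<gamma>)" "fst (snd \<gamma>) \<noteq> snd (snd \<gamma>)"
    using assms g.pair_graph_axioms by (simp_all add: \<gamma>)
qed

lemma gdecI:
  assumes "dec (N + 4) R"
    and "\<And>\<gamma> A. edge_gadget \<gamma> \<Longrightarrow> (\<And>i. A i \<subseteq> pverts (fst \<gamma>)) \<Longrightarrow> (\<And>i. finite (A i)) \<Longrightarrow>
      D \<gamma> A \<longleftrightarrow> R (gargs N \<gamma> A)"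
  shows "gdec N D"
  unfolding gdec_def using assms edge_gadgetD(2) finite_subset by metis

lemma set_encode_eq_0_iff: "finite X \<Longrightarrow> set_encode X = 0 \<longleftrightarrow> X = {}"
  using set_encode_eq[of X "{}"] by simp

lemma finite_atoms: "finite (atoms N)"
  unfolding atoms_def by simp

lemma gdec_atoms: assumes "D \<in> atoms N" shows "gdec N D"
proof -
  have arg: "recf (N + 4) (\<lambda>xs. xs ! (i + 4))" if "i < N" for i
    using that by (intro recf_nth) simp
  have const: "recf (N + 4) (\<lambda>xs. xs ! k)" if "k < 4" for k
    using that by (intro recf_nth) simp
  have const': "recf (Suc (Suc (N + 4))) (\<lambda>xs. tl (tl xs) ! k)" if "k < 4" for k
    by (intro recf_tl const that)
  have empty: "gdec N (\<lambda>\<gamma> A. A i = {})" if "i < N" for i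
    by (rule gdecI[of N "\<lambda>xs. xs ! (i + 4) = 0"])
      (use that in \<open>simp_all add: nth_gargs set_encode_eq_0_iff dec_eq recf_const arg\<close>)
  have sing: "gdec N (\<lambda>\<gamma> A. is_singleton (A i))" if "i < N" for i
  proof (rule gdecI)
    \<comment> \<open>The singleton of k has code 2^k, and k < 2^k makes the search bounded.\<close>
    show "dec (N + 4) (\<lambda>xs. \<exists>k<xs ! (i + 4). xs ! (i + 4) = 2 ^ k)"
      by (intro dec_intros recf_intros arg that)
    fix \<gamma> and A :: "nat \<Rightarrow> nat set" assume "\<And>i. finite (A i)"
    then have "A i = {k} \<longleftrightarrow> set_encode (A i) = 2 ^ k" for k :: nat
      using set_encode_eq[of "A i" "{k}"] by (simp add: set_encode_def)
    then show "is_singleton (A i) \<longleftrightarrow> (\<exists>k<gargs N \<gamma> A ! (i + 4). gargs N \<gamma> A ! (i + 4) = 2 ^ k)"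
      unfolding is_singleton_def nth_gargs(5)[OF that] by (metis less_exp)
  qed
  have node: "gdec N (\<lambda>\<gamma> A. fst (snd \<gamma>) \<in> A i)" "gdec N (\<lambda>\<gamma> A. snd (snd \<gamma>) \<in> A i)" if "i < N" for i
    by (rule gdecI[of N "\<lambda>xs. xs ! 2 \<in> set_decode (xs ! (i + 4))"],
        use that in \<open>simp_all add: nth_gargs dec_mem_set_decode const arg\<close>)
      (rule gdecI[of N "\<lambda>xs. xs ! 3 \<in> set_decode (xs ! (i + 4))"],
        use that in \<open>simp_all add: nth_gargs dec_mem_set_decode const arg\<close>)
  have sub: "gdec N (\<lambda>\<gamma> A. A i \<subseteq> A j)" if "i < N" "j < N" for i j
    by (rule gdecI[of N "\<lambda>xs. set_decode (xs ! (i + 4)) \<subseteq> set_decode (xs ! (j + 4))"])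
      (use that in \<open>simp_all add: nth_gargs dec_set_decode_subset arg\<close>)
  have edge: "gdec N (\<lambda>\<gamma> A. \<exists>x\<in>A i. \<exists>y\<in>A j. (x, y) \<in> parcs (fst \<gamma>))" if "i < N" "j < N" for i j
  proof (rule gdecI)
    show "dec (N + 4) (\<lambda>xs. \<exists>x<xs ! (i + 4). \<exists>y<xs ! (j + 4). x \<in> set_decode (xs ! (i + 4)) \<and>
        y \<in> set_decode (xs ! (j + 4)) \<and> prod_encode (x, y) \<in> set_decode (xs ! 1))" (is "dec _ ?R")
      by (intro dec_intros dec_mem_set_decode recf_intros arg const that) simp
    fix \<gamma> and A :: "nat \<Rightarrow> nat set"
    assume \<gamma>: "edge_gadget \<gamma>" and A: "\<And>i. finite (A i)"
    have "prod_encode (x, y) \<in> set_decode (gargs N \<gamma> A ! 1) \<longleftrightarrow> (x, y) \<in> parcs (fst \<gamma>)" for x y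
      unfolding nth_gargs using edge_gadgetD(3)[OF \<gamma>]
      by (simp add: inj_image_mem_iff[OF inj_prod_encode])
    moreover have "x < set_encode (A k)" if "x \<in> A k" for x k
      using that A set_decode_less[of x "set_encode (A k)"] by simp
    ultimately show "(\<exists>x\<in>A i. \<exists>y\<in>A j. (x, y) \<in> parcs (fst \<gamma>)) \<longleftrightarrow> ?R (gargs N \<gamma> A)"
      unfolding nth_gargs(5)[OF that(1)] nth_gargs(5)[OF that(2)] using A
      by (simp only: set_encode_inverse) blast
  qed
  show ?thesis
    using assms empty sing node sub edge unfolding atoms_def by blast
qed

lemma finite_moves: "finite F \<Longrightarrow> finite (moves F i)"
  unfolding moves_def by simp

text \<open>Choosing X is a bounded search: a subset of the vertex set has a code at most that of
  the vertex set. Comparing truth values over the fixed finite F is a finite conjunction.\<close>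

lemma gdec_moves:
  assumes "finite F" "\<And>D. D \<in> F \<Longrightarrow> gdec N D" "i < N" "M \<in> moves F i"
  shows "gdec N M"
proof -
  obtain S where M: "M = move F i S" using assms(4) unfolding moves_def by blast
  obtain R where R: "\<And>D. D \<in> F \<Longrightarrow> dec (N + 4) (R D)"
    "\<And>D \<gamma> A. D \<in> F \<Longrightarrow> edge_gadget \<gamma> \<Longrightarrow> (\<forall>i. A i \<subseteq> pverts (fst \<gamma>)) \<Longrightarrow> D \<gamma> A \<longleftrightarrow> R D (gargs N \<gamma> A)"
    using assms(2) unfolding gdec_def by metis
  let ?upd = "\<lambda>xs k. map (\<lambda>j. if j = i + 4 then k else xs ! j) [0..<N + 4]"
  \<comment> \<open>\<open>Suc\<close> admits the code of the whole vertex set.\<close>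
  let ?Q = "\<lambda>xs. \<exists>k<Suc (xs ! 0). set_decode k \<subseteq> set_decode (xs ! 0) \<and>
    (\<forall>D\<in>F. D \<in> S \<longleftrightarrow> R D (?upd xs k))"
  have nth: "recf (N + 4) (\<lambda>xs. xs ! j)" if "j < N + 4" for j
    by (rule recf_nth[OF that])
  have upd: "dec (Suc (N + 4)) (\<lambda>ys. R D (?upd (tl ys) (hd ys)))" if "D \<in> F" for D
  proof (rule dec_subst[OF R(1)[OF that]])
    fix j assume "j < N + 4"
    then show "recf (Suc (N + 4)) (\<lambda>ys. if j = i + 4 then hd ys else tl ys ! j)"
      using recf_hd recf_tl[OF nth] by (cases "j = i + 4") (simp_all only: if_True if_False simp_thms)
  qed
  have "dec (N + 4) ?Q"
    by (intro dec_Ex_less dec_conj dec_set_decode_subset recf_intros nth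
        dec_Ball_finite assms(1) dec_iff_const upd) simp_all
  then show ?thesis
  proof (rule gdecI)
    fix \<gamma> and A :: "nat \<Rightarrow> nat set"
    assume \<gamma>: "edge_gadget \<gamma>" and A: "\<And>i. A i \<subseteq> pverts (fst \<gamma>)"
    let ?V = "pverts (fst \<gamma>)"
    note fin = edge_gadgetD(2)[OF \<gamma>]
    have upd: "?upd (gargs N \<gamma> A) k = gargs N \<gamma> (A(i := set_decode k))" for k
    proof (rule nth_equalityI)
      fix j assume "j < length (?upd (gargs N \<gamma> A) k)"
      then have j: "j < N + 4" by simp
      have "j = 0 \<or> j = 1 \<or> j = 2 \<or> j = 3 \<or> j = (j - 4) + 4 \<and> j - 4 < N"
        using j by presburger
      then consider "j = 0" | "j = 1" | "j = 2" | "j = 3" | l where "j = l + 4" "l < N" by blast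
      then show "?upd (gargs N \<gamma> A) k ! j = gargs N \<gamma> (A(i := set_decode k)) ! j"
      proof cases
        case 5
        then show ?thesis using j by (simp add: nth_gargs del: upt_Suc)
      qed (use j in \<open>simp_all add: gargs_def del: upt_Suc\<close>)
    qed (simp add: length_gargs)
    have R': "D \<gamma> (A(i := set_decode k)) \<longleftrightarrow> R D (?upd (gargs N \<gamma> A) k)"
      if "D \<in> F" "set_decode k \<subseteq> ?V" for D k
      unfolding upd using A that \<gamma> by (intro R(2)) auto
    show "M \<gamma> A \<longleftrightarrow> ?Q (gargs N \<gamma> A)"
    proof
      assume "M \<gamma> A"
      then obtain X where X: "X \<subseteq> ?V" "\<And>D. D \<in> F \<Longrightarrow> D \<in> S \<longleftrightarrow> D \<gamma> (A(i := X))"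
        unfolding M move_def by blast
      have fX: "finite X" using X(1) fin by (rule finite_subset)
      have "set_encode X \<le> set_encode ?V"
        unfolding set_encode_def using X(1) fin by (intro sum_mono2) auto
      then show "?Q (gargs N \<gamma> A)"
        using X fin fX R'[of _ "set_encode X"]
        by (intro exI[of _ "set_encode X"]) (simp add: nth_gargs less_Suc_eq_le)
    next
      assume "?Q (gargs N \<gamma> A)"
      then obtain k where "set_decode k \<subseteq> ?V" "\<And>D. D \<in> F \<Longrightarrow> D \<in> S \<longleftrightarrow> R D (?upd (gargs N \<gamma> A) k)"
        using fin unfolding nth_gargs by auto
      then show "M \<gamma> A" unfolding M move_def using R' by blast
    qed
  qed
qed

text \<open>The pattern of truth values realised by X is described by a member of
  \<open>moves F i\<close>. That member holds on the left, hence on the right, and its witness there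
  is the answer X'.\<close>

lemma moves_response:
  assumes "\<And>M. M \<in> moves F i \<Longrightarrow> M \<gamma> A \<longleftrightarrow> M \<gamma>' A'" "X \<subseteq> pverts (fst \<gamma>)"
  shows "\<exists>X'\<subseteq>pverts (fst \<gamma>'). \<forall>D\<in>F. D \<gamma> (A(i := X)) \<longleftrightarrow> D \<gamma>' (A'(i := X'))"
proof -
  let ?S = "{D \<in> F. D \<gamma> (A(i := X))}"
  have "move F i ?S \<gamma> A" unfolding move_def using assms(2) by blast
  moreover have "move F i ?S \<in> moves F i" unfolding moves_def by blast
  ultimately have "move F i ?S \<gamma>' A'" using assms(1) by blast
  then show ?thesis unfolding move_def by blast
qed

text \<open>Q depends only on the truth pattern of the gadget over F, and F has finitely many
  patterns. The algorithm decodes the gadget, evaluates F with all sets empty and looks the result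
  up.\<close>

lemma decidable_for_gadget_pattern:
  assumes F: "finite F" "\<And>D. D \<in> F \<Longrightarrow> gdec N D"
    and Q: "\<And>\<gamma> \<gamma>'. edge_gadget \<gamma> \<Longrightarrow> edge_gadget \<gamma>' \<Longrightarrow>
      (\<And>D. D \<in> F \<Longrightarrow> D \<gamma> (\<lambda>_. {}) \<longleftrightarrow> D \<gamma>' (\<lambda>_. {})) \<Longrightarrow> Q \<gamma> \<Longrightarrow> Q \<gamma>'"
  shows "decidable_for gadget_code edge_gadget Q"
proof -
  obtain R where R: "\<And>D. D \<in> F \<Longrightarrow> dec (N + 4) (R D)"
    "\<And>D \<gamma> A. D \<in> F \<Longrightarrow> edge_gadget \<gamma> \<Longrightarrow> (\<forall>i. A i \<subseteq> pverts (fst \<gamma>)) \<Longrightarrow> D \<gamma> A \<longleftrightarrow> R D (gargs N \<gamma> A)"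
    using F(2) unfolding gdec_def by metis
  \<comment> \<open>Unpacks \<open>gadget_code\<close>; the value 0 from position 4 on is the code
    of the empty set.\<close>
  define h :: "nat \<Rightarrow> nat list \<Rightarrow> nat" where "h j =
    (if j = 0 then \<lambda>xs. fst (prod_decode (fst (prod_decode (hd xs))))
     else if j = 1 then \<lambda>xs. snd (prod_decode (fst (prod_decode (hd xs))))
     else if j = 2 then \<lambda>xs. fst (prod_decode (snd (prod_decode (hd xs))))
     else if j = 3 then \<lambda>xs. snd (prod_decode (snd (prod_decode (hd xs))))
     else (\<lambda>xs. 0))" for j
  have "recf (Suc 0) (h j)" for j
    unfolding h_def
    by (simp add: recf_fst_prod_decode recf_snd_prod_decode recf_hd recf_const)
  then have dec: "dec (Suc 0) (\<lambda>xs. R D (map (\<lambda>j. h j xs) [0..<N + 4]))" if "D \<in> F" for D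
    by (rule dec_subst[OF R(1)[OF that]])
  have h: "map (\<lambda>j. h j [gadget_code \<gamma>]) [0..<N + 4] = gargs N \<gamma> (\<lambda>_. {})" for \<gamma>
  proof -
    obtain g c d where \<gamma>: "\<gamma> = (g, c, d)" by (metis prod.exhaust)
    have "[0..<N + 4] = [0, 1, 2, 3] @ map (\<lambda>i. i + 4) [0..<N]"
    proof -
      have "[0..<4] = [0, 1, 2, 3 :: nat]" by (simp add: eval_nat_numeral)
      then show ?thesis
        using upt_add_eq_append[of 0 4 N] map_add_upt[of 4 N] by (simp add: add.commute)
    qed
    then show ?thesis by (simp add: h_def \<gamma> gargs_def comp_def)
  qed
  \<comment> \<open>The table: all patterns of gadgets that satisfy Q. It is finite as a subset of
    \<open>Pow F\<close>.\<close>
  define T where "T = {S \<in> Pow F. \<exists>\<gamma>. edge_gadget \<gamma> \<and> Q \<gamma> \<and> S = {D \<in> F. D \<gamma> (\<lambda>_. {})}}"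
  let ?A = "\<lambda>xs. \<exists>S\<in>T. \<forall>D\<in>F. D \<in> S \<longleftrightarrow> R D (map (\<lambda>j. h j xs) [0..<N + 4])"
  have "finite T" by (rule finite_subset[of _ "Pow F"]) (use F(1) in \<open>auto simp: T_def\<close>)
  then have "dec (Suc 0) ?A"
    by (intro dec_Bex_finite dec_Ball_finite dec_iff_const dec F(1))
  then obtain f where f: "recursive 1 f" "\<And>xs. length xs = 1 \<Longrightarrow> f xs = of_bool (?A xs)"
    unfolding dec_def recf_def One_nat_def by blast
  have "f [gadget_code \<gamma>] = (if Q \<gamma> then 1 else 0)" if \<gamma>: "edge_gadget \<gamma>" for \<gamma>
  proof -
    have eq: "?A [gadget_code \<gamma>] \<longleftrightarrow> (\<exists>S\<in>T. \<forall>D\<in>F. D \<in> S \<longleftrightarrow> D \<gamma> (\<lambda>_. {}))"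
      unfolding h using R(2)[OF _ \<gamma>, of _ "\<lambda>_. {}", symmetric] by simp
    have "(\<exists>S\<in>T. \<forall>D\<in>F. D \<in> S \<longleftrightarrow> D \<gamma> (\<lambda>_. {})) \<longleftrightarrow> Q \<gamma>"
    proof
      assume "\<exists>S\<in>T. \<forall>D\<in>F. D \<in> S \<longleftrightarrow> D \<gamma> (\<lambda>_. {})"
      then obtain S where S: "S \<in> T" "\<And>D. D \<in> F \<Longrightarrow> D \<in> S \<longleftrightarrow> D \<gamma> (\<lambda>_. {})" by metis
      from S(1) obtain \<delta> where \<delta>: "edge_gadget \<delta>" "Q \<delta>" "S = {D \<in> F. D \<delta> (\<lambda>_. {})}"
        unfolding T_def by (elim CollectE conjE exE)
      have "D \<delta> (\<lambda>_. {}) \<longleftrightarrow> D \<gamma> (\<lambda>_. {})" if "D \<in> F" for D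
        using S(2)[OF that] that unfolding \<delta>(3) by simp
      then show "Q \<gamma>" by (rule Q[OF \<delta>(1) \<gamma> _ \<delta>(2)])
    next
      assume "Q \<gamma>"
      show "\<exists>S\<in>T. \<forall>D\<in>F. D \<in> S \<longleftrightarrow> D \<gamma> (\<lambda>_. {})"
      proof (rule bexI)
        show "{D \<in> F. D \<gamma> (\<lambda>_. {})} \<in> T" 
          unfolding T_def by (intro CollectI conjI PowI Collect_restrict exI[of _ \<gamma>] \<gamma> \<open>Q \<gamma>\<close> refl)
      qed simp
    qed
    then show ?thesis using f(2)[of "[gadget_code \<gamma>]"] eq by simp
  qed
  then show ?thesis unfolding decidable_for_def using f(1) by blast
qed

section \<open>Transfer of truth between two reductions\<close>

text \<open>What X looks like from inside one copy, in terms of nodes of the gadget itself, so that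
  gadget properties apply to it.\<close>

definition trace :: "gadget \<Rightarrow> fgraph \<Rightarrow> nat \<Rightarrow> nat \<Rightarrow> nat set \<Rightarrow> nat set" where
  "trace \<gamma> G u v X = {w \<in> pverts (fst \<gamma>). gadget_copy G \<gamma> u v w \<in> X}"

text \<open>The invariant of the game. Both reductions are built over the same G, so their copies
  are indexed by the same edges and compared one by one. F holds what must still agree: atoms and
  the properties for rounds to come.\<close>

definition sim :: "gprop set \<Rightarrow> fgraph \<Rightarrow> gadget \<Rightarrow> gadget \<Rightarrow>
    (nat \<Rightarrow> nat set) \<Rightarrow> (nat \<Rightarrow> nat set) \<Rightarrow> bool" where
  "sim F G \<gamma> \<gamma>' \<sigma> \<sigma>' \<longleftrightarrow>
     (\<forall>i. \<sigma> i \<subseteq> pverts (edge_gadget_reduction \<gamma> G) \<and> \<sigma>' i \<subseteq> pverts (edge_gadget_reduction \<gamma>' G) \<and>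
        \<sigma> i \<inter> pverts G = \<sigma>' i \<inter> pverts G) \<and>
     (\<forall>u v. (u, v) \<in> parcs G \<longrightarrow> u < v \<longrightarrow>
        (\<forall>D\<in>F. D \<gamma> (\<lambda>i. trace \<gamma> G u v (\<sigma> i)) \<longleftrightarrow> D \<gamma>' (\<lambda>i. trace \<gamma>' G u v (\<sigma>' i))))"

text \<open>Both kinds of variables are stored in one family of sets: the element variable x is the
  singleton at the even index 2x, the set variable X sits at the odd index 2X + 1.\<close>

definition represents :: "mso \<Rightarrow> (nat \<Rightarrow> nat set) \<Rightarrow> (nat \<Rightarrow> nat) \<Rightarrow> (nat \<Rightarrow> nat set) \<Rightarrow> bool" where
  "represents \<phi> \<sigma> e s \<longleftrightarrow> (\<forall>x\<in>free_elem_vars \<phi>. \<sigma> (2 * x) = {e x}) \<and>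
     (\<forall>X\<in>free_set_vars \<phi>. \<sigma> (Suc (2 * X)) = s X)"

text \<open>An implication suffices because \<open>sim\<close> is symmetric in the two gadgets.
  Graph, gadgets and assignments are quantified inside, so one F serves them all.\<close>

definition determines :: "gprop set \<Rightarrow> mso \<Rightarrow> bool" where
  "determines F \<phi> \<longleftrightarrow> (\<forall>G \<gamma> \<gamma>' \<sigma> \<sigma>' e e' s s'. pair_graph G \<longrightarrow> edge_gadget \<gamma> \<longrightarrow> edge_gadget \<gamma>' \<longrightarrow>
     sim F G \<gamma> \<gamma>' \<sigma> \<sigma>' \<longrightarrow> represents \<phi> \<sigma> e s \<longrightarrow> represents \<phi> \<sigma>' e' s' \<longrightarrow>
     mso_sat (edge_gadget_reduction \<gamma> G) e s \<phi> \<longrightarrow> mso_sat (edge_gadget_reduction \<gamma>' G) e' s' \<phi>)"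

text \<open>Exceeds every index 2x or 2X + 1 of a variable of the formula, free or bound, so that
  all properties met in the induction can share one arity.\<close>

fun index_bound :: "mso \<Rightarrow> nat" where
  "index_bound (Eq x y) = 2 * (x + y) + 2"
| "index_bound (Edge x y) = 2 * (x + y) + 2"
| "index_bound (Mem x X) = 2 * (x + X) + 2"
| "index_bound (Neg \<phi>) = index_bound \<phi>"
| "index_bound (Conj \<phi> \<psi>) = max (index_bound \<phi>) (index_bound \<psi>)"
| "index_bound (Ex_elem x \<phi>) = max (2 * x + 2) (index_bound \<phi>)"
| "index_bound (Ex_set X \<phi>) = max (2 * X + 2) (index_bound \<phi>)"

lemma sim_sym: "sim F G \<gamma> \<gamma>' \<sigma> \<sigma>' \<Longrightarrow> sim F G \<gamma>' \<gamma> \<sigma>' \<sigma>"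
  unfolding sim_def by metis

lemma sim_mono: "sim F G \<gamma> \<gamma>' \<sigma> \<sigma>' \<Longrightarrow> F' \<subseteq> F \<Longrightarrow> sim F' G \<gamma> \<gamma>' \<sigma> \<sigma>'"
  unfolding sim_def by blast

lemma determines_mono: "determines F \<phi> \<Longrightarrow> F \<subseteq> F' \<Longrightarrow> determines F' \<phi>"
  unfolding determines_def using sim_mono by metis

lemma determines_iff:
  assumes "determines F \<phi>" "pair_graph G" "edge_gadget \<gamma>" "edge_gadget \<gamma>'"
    "sim F G \<gamma> \<gamma>' \<sigma> \<sigma>'" "represents \<phi> \<sigma> e s" "represents \<phi> \<sigma>' e' s'"
  shows "mso_sat (edge_gadget_reduction \<gamma> G) e s \<phi> \<longleftrightarrow> mso_sat (edge_gadget_reduction \<gamma>' G) e' s' \<phi>"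
  using assms sim_sym[OF assms(5)] unfolding determines_def by meson

section \<open>Nodes, edges and traces of a reduction\<close>

lemma pverts_reduction: "pverts (edge_gadget_reduction \<gamma> G) = pverts G \<union>
    {gadget_copy G \<gamma> u v w | u v w. (u, v) \<in> parcs G \<and> u < v \<and> w \<in> pverts (fst \<gamma>)}"
  by (cases \<gamma>) (simp del: gadget_copy.simps)

lemma parcs_reduction: "parcs (edge_gadget_reduction \<gamma> G) =
    {(gadget_copy G \<gamma> u v x, gadget_copy G \<gamma> u v y) | u v x y.
       (u, v) \<in> parcs G \<and> u < v \<and> (x, y) \<in> parcs (fst \<gamma>)}"
  by (cases \<gamma>) (simp del: gadget_copy.simps)

lemma gadget_copy_ends:
  assumes "edge_gadget \<gamma>"
  shows "gadget_copy G \<gamma> u v (fst (snd \<gamma>)) = u" "gadget_copy G \<gamma> u v (snd (snd \<gamma>)) = v"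
  using assms by (cases \<gamma>; simp)+

lemma gadget_copy_inner_notin:
  assumes "pair_graph G" "w \<noteq> fst (snd \<gamma>)" "w \<noteq> snd (snd \<gamma>)"
  shows "gadget_copy G \<gamma> u v w \<notin> pverts G"
proof
  interpret pair_graph G by fact
  obtain g c d where \<gamma>: "\<gamma> = (g, c, d)" by (metis prod.exhaust)
  assume "gadget_copy G \<gamma> u v w \<in> pverts G"
  \<comment> \<open>Taken as a vertex of G, the node would be smaller than itself.\<close>
  from gadget_copy_gt[OF pair_finite_verts this, of w c d g u v] assms(2,3) \<gamma> show False by simp
qed

lemma gadget_copy_inner_eqD:
  assumes "gadget_copy G \<gamma> u v w = gadget_copy G \<gamma> u' v' w'"
    "w \<noteq> fst (snd \<gamma>)" "w \<noteq> snd (snd \<gamma>)" "w' \<noteq> fst (snd \<gamma>)" "w' \<noteq> snd (snd \<gamma>)"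
  shows "u = u' \<and> v = v' \<and> w = w'"
  using assms by (cases \<gamma>) simp

lemma trace_ends:
  assumes "edge_gadget \<gamma>"
  shows "fst (snd \<gamma>) \<in> trace \<gamma> G u v X \<longleftrightarrow> u \<in> X" "snd (snd \<gamma>) \<in> trace \<gamma> G u v X \<longleftrightarrow> v \<in> X"
  using edge_gadgetD(4,5)[OF assms] by (simp_all add: trace_def gadget_copy_ends[OF assms])

lemma trace_subset: "trace \<gamma> G u v X \<subseteq> pverts (fst \<gamma>)"
  unfolding trace_def by blast

lemma subset_iff_trace:
  assumes "X \<subseteq> pverts (edge_gadget_reduction \<gamma> G)"
  shows "X \<subseteq> Y \<longleftrightarrow> X \<inter> pverts G \<subseteq> Y \<inter> pverts G \<and>
    (\<forall>u v. (u, v) \<in> parcs G \<longrightarrow> u < v \<longrightarrow> trace \<gamma> G u v X \<subseteq> trace \<gamma> G u v Y)"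
  using assms unfolding pverts_reduction trace_def by blast

text \<open>The reduction has no edges other than those of its copies, so each edge is seen by the
  traces in a single copy.\<close>

lemma edge_iff_trace:
  assumes "edge_gadget \<gamma>"
  shows "(\<exists>x\<in>X. \<exists>y\<in>Y. (x, y) \<in> parcs (edge_gadget_reduction \<gamma> G)) \<longleftrightarrow>
    (\<exists>u v. (u, v) \<in> parcs G \<and> u < v \<and>
      (\<exists>x\<in>trace \<gamma> G u v X. \<exists>y\<in>trace \<gamma> G u v Y. (x, y) \<in> parcs (fst \<gamma>)))"
proof -
  interpret g: pair_graph "fst \<gamma>" by (rule edge_gadgetD(1)[OF assms])
  show ?thesis
  proof
    assume "\<exists>x\<in>X. \<exists>y\<in>Y. (x, y) \<in> parcs (edge_gadget_reduction \<gamma> G)"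
    then obtain u v x y where uv: "(u, v) \<in> parcs G" "u < v" and xy: "(x, y) \<in> parcs (fst \<gamma>)"
      "gadget_copy G \<gamma> u v x \<in> X" "gadget_copy G \<gamma> u v y \<in> Y"
      unfolding parcs_reduction by auto
    then have "x \<in> trace \<gamma> G u v X" "y \<in> trace \<gamma> G u v Y"
      using g.in_arcsD1[OF xy(1)] g.in_arcsD2[OF xy(1)] unfolding trace_def by simp_all
    then show "\<exists>u v. (u, v) \<in> parcs G \<and> u < v \<and>
        (\<exists>x\<in>trace \<gamma> G u v X. \<exists>y\<in>trace \<gamma> G u v Y. (x, y) \<in> parcs (fst \<gamma>))"
      using uv xy(1) by blast
  next
    assume "\<exists>u v. (u, v) \<in> parcs G \<and> u < v \<and>
      (\<exists>x\<in>trace \<gamma> G u v X. \<exists>y\<in>trace \<gamma> G u v Y. (x, y) \<in> parcs (fst \<gamma>))"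
    then obtain u v x y where uv: "(u, v) \<in> parcs G" "u < v" and xy: "(x, y) \<in> parcs (fst \<gamma>)"
      "gadget_copy G \<gamma> u v x \<in> X" "gadget_copy G \<gamma> u v y \<in> Y"
      unfolding trace_def by blast
    have "(gadget_copy G \<gamma> u v x, gadget_copy G \<gamma> u v y) \<in> parcs (edge_gadget_reduction \<gamma> G)"
      unfolding parcs_reduction using uv xy(1) by blast
    then show "\<exists>x\<in>X. \<exists>y\<in>Y. (x, y) \<in> parcs (edge_gadget_reduction \<gamma> G)"
      using xy(2,3) by blast
  qed
qed

section \<open>Atomic facts and one round of the game across all copies\<close>

lemma atoms_memI:
  assumes "i < N"
  shows "(\<lambda>\<gamma> A. A i = {}) \<in> atoms N" "(\<lambda>\<gamma> A. is_singleton (A i)) \<in> atoms N"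
    "(\<lambda>\<gamma> A. fst (snd \<gamma>) \<in> A i) \<in> atoms N" "(\<lambda>\<gamma> A. snd (snd \<gamma>) \<in> A i) \<in> atoms N"
    "j < N \<Longrightarrow> (\<lambda>\<gamma> A. A i \<subseteq> A j) \<in> atoms N"
    "j < N \<Longrightarrow> (\<lambda>\<gamma> A. \<exists>x\<in>A i. \<exists>y\<in>A j. (x, y) \<in> parcs (fst \<gamma>)) \<in> atoms N"
  using assms unfolding atoms_def by blast+

lemma simD:
  assumes "sim F G \<gamma> \<gamma>' \<sigma> \<sigma>'"
  shows "\<sigma> i \<subseteq> pverts (edge_gadget_reduction \<gamma> G)" "\<sigma>' i \<subseteq> pverts (edge_gadget_reduction \<gamma>' G)"
    "\<sigma> i \<inter> pverts G = \<sigma>' i \<inter> pverts G"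
    "(u, v) \<in> parcs G \<Longrightarrow> u < v \<Longrightarrow> D \<in> F \<Longrightarrow>
      D \<gamma> (\<lambda>i. trace \<gamma> G u v (\<sigma> i)) \<longleftrightarrow> D \<gamma>' (\<lambda>i. trace \<gamma>' G u v (\<sigma>' i))"
  using assms unfolding sim_def by blast+

lemma sim_subset:
  assumes "sim F G \<gamma> \<gamma>' \<sigma> \<sigma>'" "atoms N \<subseteq> F" "i < N" "j < N" "\<sigma> i \<subseteq> \<sigma> j"
  shows "\<sigma>' i \<subseteq> \<sigma>' j"
proof -
  have "trace \<gamma>' G u v (\<sigma>' i) \<subseteq> trace \<gamma>' G u v (\<sigma>' j)" if "(u, v) \<in> parcs G" "u < v" for u v
  proof -
    have "trace \<gamma> G u v (\<sigma> i) \<subseteq> trace \<gamma> G u v (\<sigma> j)" using assms(5) unfolding trace_def by blast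
    then show ?thesis
      using simD(4)[OF assms(1) that subsetD[OF assms(2) atoms_memI(5)[OF assms(3,4)]]] by simp
  qed
  moreover have "\<sigma>' i \<inter> pverts G \<subseteq> \<sigma>' j \<inter> pverts G"
    using simD(3)[OF assms(1), of i] simD(3)[OF assms(1), of j] assms(5) by auto
  ultimately show ?thesis unfolding subset_iff_trace[OF simD(2)[OF assms(1)]] by simp
qed

lemma sim_edge:
  assumes "sim F G \<gamma> \<gamma>' \<sigma> \<sigma>'" "atoms N \<subseteq> F" "i < N" "j < N" "edge_gadget \<gamma>" "edge_gadget \<gamma>'"
    "\<exists>x\<in>\<sigma> i. \<exists>y\<in>\<sigma> j. (x, y) \<in> parcs (edge_gadget_reduction \<gamma> G)"
  shows "\<exists>x\<in>\<sigma>' i. \<exists>y\<in>\<sigma>' j. (x, y) \<in> parcs (edge_gadget_reduction \<gamma>' G)"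
proof -
  obtain u v where uv: "(u, v) \<in> parcs G" "u < v"
    "\<exists>x\<in>trace \<gamma> G u v (\<sigma> i). \<exists>y\<in>trace \<gamma> G u v (\<sigma> j). (x, y) \<in> parcs (fst \<gamma>)"
    using assms(7) unfolding edge_iff_trace[OF assms(5)] by blast
  then have "\<exists>x\<in>trace \<gamma>' G u v (\<sigma>' i). \<exists>y\<in>trace \<gamma>' G u v (\<sigma>' j). (x, y) \<in> parcs (fst \<gamma>')"
    using simD(4)[OF assms(1) uv(1,2) subsetD[OF assms(2) atoms_memI(6)[OF assms(3,4)]]] by simp
  then show ?thesis unfolding edge_iff_trace[OF assms(6)] using uv(1,2) by blast
qed

text \<open>Not a local matter: a vertex of G is seen in the copy at each incident edge, an inner
  node in just one copy. For a in G, a second element inside some copy must be excluded; for an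
  inner a, also vertices of G and other copies.\<close>

lemma sim_singleton:
  assumes sim: "sim F G \<gamma> \<gamma>' \<sigma> \<sigma>'" and F: "atoms N \<subseteq> F" and i: "i < N"
    and G: "pair_graph G" and \<gamma>: "edge_gadget \<gamma>" "edge_gadget \<gamma>'" and a: "\<sigma> i = {a}"
  shows "\<exists>a'. \<sigma>' i = {a'}"
proof -
  let ?c = "fst (snd \<gamma>)" and ?d = "snd (snd \<gamma>)" and ?c' = "fst (snd \<gamma>')" and ?d' = "snd (snd \<gamma>')"
  let ?t = "\<lambda>u v. trace \<gamma> G u v {a}" and ?t' = "\<lambda>u v. trace \<gamma>' G u v (\<sigma>' i)"
  interpret G: pair_graph G by fact
  have atom: "?t u v = {} \<longleftrightarrow> ?t' u v = {}" "is_singleton (?t u v) \<longleftrightarrow> is_singleton (?t' u v)"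
    "?c \<in> ?t u v \<longleftrightarrow> ?c' \<in> ?t' u v" "?d \<in> ?t u v \<longleftrightarrow> ?d' \<in> ?t' u v" if "(u, v) \<in> parcs G" "u < v" for u v
    using simD(4)[OF sim that subsetD[OF F atoms_memI(1)[OF i]]]
      simD(4)[OF sim that subsetD[OF F atoms_memI(2)[OF i]]]
      simD(4)[OF sim that subsetD[OF F atoms_memI(3)[OF i]]]
      simD(4)[OF sim that subsetD[OF F atoms_memI(4)[OF i]]] unfolding a by simp_all
  have outer: "w = ?c \<or> w = ?d" if "gadget_copy G \<gamma> u v w \<in> pverts G" for u v w
    using gadget_copy_inner_notin[OF G] that by blast
  have V: "\<sigma>' i \<inter> pverts G = {a} \<inter> pverts G" using simD(3)[OF sim, of i] a by simp
  have copy: "\<exists>u v w. (u, v) \<in> parcs G \<and> u < v \<and> w \<in> ?t' u v \<and> z = gadget_copy G \<gamma>' u v w"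
    if "z \<in> \<sigma>' i" "z \<notin> pverts G" for z
    using simD(2)[OF sim, of i] that unfolding pverts_reduction trace_def by blast
  show ?thesis
  proof (cases "a \<in> pverts G")
    case True
    \<comment> \<open>A further node z would lie in a copy where the first trace is nonempty. That
      trace is a single end, so the second is a single end too, and z is a vertex of G after
      all.\<close>
    have "z \<in> pverts G" if z: "z \<in> \<sigma>' i" for z
    proof (rule ccontr)
      assume "z \<notin> pverts G"
      from copy[OF z this] obtain u v w where uv: "(u, v) \<in> parcs G" "u < v"
        and w: "w \<in> ?t' u v" "z = gadget_copy G \<gamma>' u v w" by blast
      have sub: "?t u v \<subseteq> {?c, ?d}" using outer True unfolding trace_def by blast
      have "\<not> (?c \<in> ?t u v \<and> ?d \<in> ?t u v)" using uv(2) unfolding trace_ends[OF \<gamma>(1)] by auto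
      moreover have "?t u v \<noteq> {}" using atom(1)[OF uv] w(1) by blast
      ultimately have "?t u v = {?c} \<or> ?t u v = {?d}" using sub by blast
      then have "is_singleton (?t u v)" "?c \<in> ?t u v \<or> ?d \<in> ?t u v"
        by (elim disjE; simp)+
      then have "is_singleton (?t' u v)" "?c' \<in> ?t' u v \<or> ?d' \<in> ?t' u v"
        unfolding atom[OF uv] .
      moreover from this(1) obtain w0 where "?t' u v = {w0}" by (elim is_singletonE)
      ultimately have "w = ?c' \<or> w = ?d'" using w(1) by auto
      then have "z \<in> pverts G"
        using w(2) gadget_copy_ends[OF \<gamma>(2)] G.in_arcsD1[OF uv(1)] G.in_arcsD2[OF uv(1)] by auto
      then show False using \<open>z \<notin> pverts G\<close> by blast
    qed
    then have "\<sigma>' i = {a}" using V True by blast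
    then show ?thesis ..
  next
    case False
    then obtain u v w where uv: "(u, v) \<in> parcs G" "u < v" and w: "w \<in> pverts (fst \<gamma>)"
      "a = gadget_copy G \<gamma> u v w" using simD(1)[OF sim, of i] a unfolding pverts_reduction by blast
    have inner: "w' \<noteq> ?c \<and> w' \<noteq> ?d" if "(u', v') \<in> parcs G" "a = gadget_copy G \<gamma> u' v' w'" for u' v' w'
      using that(2) False G.in_arcsD1[OF that(1)] G.in_arcsD2[OF that(1)]
        gadget_copy_ends[OF \<gamma>(1), of G u' v'] by auto
    \<comment> \<open>An inner node determines its edge and its gadget node, so a is seen in no
      other copy.\<close>
    have unique: "u' = u \<and> v' = v \<and> w' = w"
      if "(u', v') \<in> parcs G" "w' \<in> ?t u' v'" for u' v' w'
    proof -
      have *: "a = gadget_copy G \<gamma> u' v' w'" using that(2) unfolding trace_def by simp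
      have "gadget_copy G \<gamma> u' v' w' = gadget_copy G \<gamma> u v w"
        by (rule trans[OF *[symmetric] w(2)])
      then show ?thesis
        by (rule gadget_copy_inner_eqD) (use inner[OF that(1) *] inner[OF uv(1) w(2)] in blast)+
    qed
    have "w \<in> ?t u v" using w unfolding trace_def by simp
    then have "?t u v = {w}" using unique[OF uv(1)] by blast
    then have "is_singleton (?t u v)" by simp
    then have "is_singleton (?t' u v)" unfolding atom(2)[OF uv] .
    then obtain w' where w': "?t' u v = {w'}" by (elim is_singletonE)
    \<comment> \<open>The second set contains no vertex of G, as both sets agree there; and a copy
      that it meets is also met by a, hence is the one at u and v.\<close>
    have "z = gadget_copy G \<gamma>' u v w'" if z: "z \<in> \<sigma>' i" for z
    proof -
      have "z \<notin> pverts G"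
      proof
        assume "z \<in> pverts G"
        then have "z \<in> {a} \<inter> pverts G" unfolding V[symmetric] using z by simp
        then show False using False by simp
      qed
      from copy[OF z this] obtain u1 v1 w1 where 1: "(u1, v1) \<in> parcs G" "u1 < v1"
        "w1 \<in> ?t' u1 v1" "z = gadget_copy G \<gamma>' u1 v1 w1" by blast
      then obtain w2 where "w2 \<in> ?t u1 v1" using atom(1)[OF 1(1,2)] by blast
      from unique[OF 1(1) this] have "u1 = u" "v1 = v" by simp_all
      then show ?thesis using 1(3,4) w' by simp
    qed
    moreover have "gadget_copy G \<gamma>' u v w' \<in> \<sigma>' i" using w' unfolding trace_def by blast
    ultimately have "\<sigma>' i = {gadget_copy G \<gamma>' u v w'}" by blast
    then show ?thesis ..
  qed
qed

text \<open>Copies meet only in vertices of G. Prescribed traces that agree with X at both ends of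
  each edge are therefore consistent and glue to one set.\<close>

lemma trace_assemble:
  assumes G: "pair_graph G" and \<gamma>: "edge_gadget \<gamma>"
    and Y: "\<And>u v. (u, v) \<in> parcs G \<Longrightarrow> u < v \<Longrightarrow> Y u v \<subseteq> pverts (fst \<gamma>) \<and>
      (fst (snd \<gamma>) \<in> Y u v \<longleftrightarrow> u \<in> X) \<and> (snd (snd \<gamma>) \<in> Y u v \<longleftrightarrow> v \<in> X)"
  shows "\<exists>Z\<subseteq>pverts (edge_gadget_reduction \<gamma> G). Z \<inter> pverts G = X \<inter> pverts G \<and>
    (\<forall>u v. (u, v) \<in> parcs G \<longrightarrow> u < v \<longrightarrow> trace \<gamma> G u v Z = Y u v)"
proof -
  let ?c = "fst (snd \<gamma>)" and ?d = "snd (snd \<gamma>)" and ?f = "gadget_copy G \<gamma>"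
  interpret G: pair_graph G by fact
  define Z where "Z = (X \<inter> pverts G) \<union> {?f u v w | u v w. (u, v) \<in> parcs G \<and> u < v \<and> w \<in> Y u v}"
  have "Z \<subseteq> pverts (edge_gadget_reduction \<gamma> G)"
    using Y unfolding Z_def pverts_reduction by blast
  moreover have V: "Z \<inter> pverts G = X \<inter> pverts G"
  proof -
    have "?f u v w \<in> X" if "(u, v) \<in> parcs G" "u < v" "w \<in> Y u v" "?f u v w \<in> pverts G" for u v w
    proof -
      have "w = ?c \<or> w = ?d" using gadget_copy_inner_notin[OF G] that(4) by blast
      then show ?thesis using Y[OF that(1,2)] that(3) gadget_copy_ends[OF \<gamma>] by auto
    qed
    then show ?thesis unfolding Z_def by blast
  qed
  moreover have "w \<in> trace \<gamma> G u v Z \<longleftrightarrow> w \<in> Y u v" if uv: "(u, v) \<in> parcs G" "u < v" for u v w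
  proof -
    have mem: "u \<in> Z \<longleftrightarrow> u \<in> X" "v \<in> Z \<longleftrightarrow> v \<in> X"
      using V G.in_arcsD1[OF uv(1)] G.in_arcsD2[OF uv(1)] by auto
    consider "w = ?c" | "w = ?d" | "w \<noteq> ?c" "w \<noteq> ?d" by blast
    then show ?thesis
    proof cases
      case 1
      then show ?thesis using trace_ends(1)[OF \<gamma>] Y[OF uv] mem by simp
    next
      case 2
      then show ?thesis using trace_ends(2)[OF \<gamma>] Y[OF uv] mem by simp
    next
      case 3
      note notin = gadget_copy_inner_notin[OF G 3, of u v]
      have "w \<in> Y u v" if "?f u v w \<in> Z"
      proof -
        obtain u' v' w' where *: "(u', v') \<in> parcs G" "w' \<in> Y u' v'" "?f u v w = ?f u' v' w'"
          using \<open>?f u v w \<in> Z\<close> notin unfolding Z_def by blast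
        \<comment> \<open>The image of an end is a vertex of G, which this node is not; being inner,
          it determines its edge.\<close>
        have "w' \<noteq> ?c" "w' \<noteq> ?d"
          using * notin gadget_copy_ends[OF \<gamma>] G.in_arcsD1[OF *(1)] G.in_arcsD2[OF *(1)] by auto
        then show ?thesis using gadget_copy_inner_eqD[OF *(3) 3] *(2) by blast
      qed
      moreover have "?f u v w \<in> Z" if "w \<in> Y u v"
        using that uv unfolding Z_def by blast
      ultimately show ?thesis using Y[OF uv] unfolding trace_def by blast
    qed
  qed
  then have "trace \<gamma> G u v Z = Y u v" if "(u, v) \<in> parcs G" "u < v" for u v
    using that by (intro set_eqI)
  ultimately show ?thesis by (intro exI[of _ Z] conjI allI impI)
qed

text \<open>Duplicator answers in every copy independently. Since F contains the atoms about ends,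
  each answer contains an end exactly if X contains the vertex there, so the answers fit together by
  \<open>trace_assemble\<close>.\<close>

lemma sim_response:
  assumes sim: "sim (atoms N \<union> moves F i) G \<gamma> \<gamma>' \<sigma> \<sigma>'" and F: "atoms N \<subseteq> F" and i: "i < N"
    and G: "pair_graph G" and \<gamma>: "edge_gadget \<gamma>" "edge_gadget \<gamma>'"
    and X: "X \<subseteq> pverts (edge_gadget_reduction \<gamma> G)"
  shows "\<exists>X'. sim F G \<gamma> \<gamma>' (\<sigma>(i := X)) (\<sigma>'(i := X'))"
proof -
  let ?T = "\<lambda>u v j. trace \<gamma> G u v (\<sigma> j)" and ?T' = "\<lambda>u v j. trace \<gamma>' G u v (\<sigma>' j)"
  have "\<exists>X'\<subseteq>pverts (fst \<gamma>'). \<forall>D\<in>F.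
      D \<gamma> ((?T u v)(i := trace \<gamma> G u v X)) \<longleftrightarrow> D \<gamma>' ((?T' u v)(i := X'))"
    if "(u, v) \<in> parcs G" "u < v" for u v
    by (rule moves_response[OF _ trace_subset]) (rule simD(4)[OF sim that UnI2])
  then obtain Y where Y: "\<And>u v. (u, v) \<in> parcs G \<Longrightarrow> u < v \<Longrightarrow> Y u v \<subseteq> pverts (fst \<gamma>')"
    "\<And>u v D. (u, v) \<in> parcs G \<Longrightarrow> u < v \<Longrightarrow> D \<in> F \<Longrightarrow>
      D \<gamma> ((?T u v)(i := trace \<gamma> G u v X)) \<longleftrightarrow> D \<gamma>' ((?T' u v)(i := Y u v))"
    by metis
  have "Y u v \<subseteq> pverts (fst \<gamma>') \<and> (fst (snd \<gamma>') \<in> Y u v \<longleftrightarrow> u \<in> X) \<and> (snd (snd \<gamma>') \<in> Y u v \<longleftrightarrow> v \<in> X)"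
    if uv: "(u, v) \<in> parcs G" "u < v" for u v
    using Y(1)[OF uv] Y(2)[OF uv subsetD[OF F atoms_memI(3)[OF i]]]
      Y(2)[OF uv subsetD[OF F atoms_memI(4)[OF i]]] trace_ends[OF \<gamma>(1)] by simp
  from trace_assemble[OF G \<gamma>(2) this] obtain X' where X': "X' \<subseteq> pverts (edge_gadget_reduction \<gamma>' G)"
    "X' \<inter> pverts G = X \<inter> pverts G"
    "\<And>u v. (u, v) \<in> parcs G \<Longrightarrow> u < v \<Longrightarrow> trace \<gamma>' G u v X' = Y u v" by blast
  have upd: "(\<lambda>j. trace \<delta> G u v ((\<tau>(i := Z)) j)) = (\<lambda>j. trace \<delta> G u v (\<tau> j))(i := trace \<delta> G u v Z)"
    for \<delta> u v \<tau> Z by (simp add: fun_eq_iff)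
  have "sim F G \<gamma> \<gamma>' (\<sigma>(i := X)) (\<sigma>'(i := X'))"
    unfolding sim_def
  proof (intro conjI allI impI ballI)
    fix u v D assume "(u, v) \<in> parcs G" "u < v" "D \<in> F"
    then show "D \<gamma> (\<lambda>j. trace \<gamma> G u v ((\<sigma>(i := X)) j)) \<longleftrightarrow>
        D \<gamma>' (\<lambda>j. trace \<gamma>' G u v ((\<sigma>'(i := X')) j))"
      unfolding upd using Y(2) X'(3) by simp
  qed (use simD(1-3)[OF sim] X X' in \<open>auto simp del: edge_gadget_reduction.simps\<close>)
  then show ?thesis ..
qed

text \<open>A quantifier at index i turns the family F of its body into
  \<open>atoms N \<union> moves F i\<close>. The atoms stay in every family because gluing and
  keeping singletons rely on them at each level.\<close>

lemma ex_determining_family: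
  assumes "index_bound \<phi> \<le> N"
  shows "\<exists>F. finite F \<and> (\<forall>D\<in>F. gdec N D) \<and> atoms N \<subseteq> F \<and> determines F \<phi>"
  using assms
proof (induction \<phi>)
  case (Eq x y)
  \<comment> \<open>Between singletons, one inclusion already is equality.\<close>
  have "determines (atoms N) (Eq x y)"
    unfolding determines_def
  proof (intro allI impI)
    fix G \<gamma> \<gamma>' \<sigma> \<sigma>' e e' s s'
    assume "sim (atoms N) G \<gamma> \<gamma>' \<sigma> \<sigma>'" "represents (Eq x y) \<sigma> e s" "represents (Eq x y) \<sigma>' e' s'"
      "mso_sat (edge_gadget_reduction \<gamma> G) e s (Eq x y)"
    then show "mso_sat (edge_gadget_reduction \<gamma>' G) e' s' (Eq x y)"
      using sim_subset[of "atoms N" G \<gamma> \<gamma>' \<sigma> \<sigma>' N "2 * x" "2 * y"] Eq.prems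
      by (simp add: represents_def del: edge_gadget_reduction.simps)
  qed
  then show ?case using finite_atoms gdec_atoms by blast
next
  case (Edge x y)
  have "determines (atoms N) (Edge x y)"
    unfolding determines_def
  proof (intro allI impI)
    fix G \<gamma> \<gamma>' \<sigma> \<sigma>' e e' s s'
    assume "sim (atoms N) G \<gamma> \<gamma>' \<sigma> \<sigma>'" "edge_gadget \<gamma>" "edge_gadget \<gamma>'"
      "represents (Edge x y) \<sigma> e s" "represents (Edge x y) \<sigma>' e' s'"
      "mso_sat (edge_gadget_reduction \<gamma> G) e s (Edge x y)"
    then show "mso_sat (edge_gadget_reduction \<gamma>' G) e' s' (Edge x y)"
      using sim_edge[of "atoms N" G \<gamma> \<gamma>' \<sigma> \<sigma>' N "2 * x" "2 * y"] Edge.prems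
      by (simp add: represents_def del: edge_gadget_reduction.simps edge_gadget.simps)
  qed
  then show ?case using finite_atoms gdec_atoms by blast
next
  case (Mem x X)
  have "determines (atoms N) (Mem x X)"
    unfolding determines_def
  proof (intro allI impI)
    fix G \<gamma> \<gamma>' \<sigma> \<sigma>' e e' s s'
    assume "sim (atoms N) G \<gamma> \<gamma>' \<sigma> \<sigma>'" "represents (Mem x X) \<sigma> e s" "represents (Mem x X) \<sigma>' e' s'"
      "mso_sat (edge_gadget_reduction \<gamma> G) e s (Mem x X)"
    then show "mso_sat (edge_gadget_reduction \<gamma>' G) e' s' (Mem x X)"
      using sim_subset[of "atoms N" G \<gamma> \<gamma>' \<sigma> \<sigma>' N "2 * x" "Suc (2 * X)"] Mem.prems
      by (simp add: represents_def del: edge_gadget_reduction.simps)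
  qed
  then show ?case using finite_atoms gdec_atoms by blast
next
  case (Neg \<phi>)
  then obtain F where F: "finite F" "\<forall>D\<in>F. gdec N D" "atoms N \<subseteq> F" "determines F \<phi>" by auto
  have rep: "represents (Neg \<phi>) = represents \<phi>" by (simp add: represents_def fun_eq_iff)
  \<comment> \<open>Negation reverses the implication; here the symmetry of \<open>sim\<close>
    enters.\<close>
  have "determines F (Neg \<phi>)"
    unfolding determines_def rep mso_sat.simps using determines_iff[OF F(4)] by blast
  then show ?case using F by blast
next
  case (Conj \<phi> \<psi>)
  then obtain F F' where F: "finite F" "\<forall>D\<in>F. gdec N D" "atoms N \<subseteq> F" "determines F \<phi>"
    and F': "finite F'" "\<forall>D\<in>F'. gdec N D" "determines F' \<psi>" by auto
  have det: "determines (F \<union> F') \<phi>" "determines (F \<union> F') \<psi>"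
    using determines_mono F(4) F'(3) by blast+
  have rep: "represents (Conj \<phi> \<psi>) \<sigma> e s \<Longrightarrow> represents \<phi> \<sigma> e s \<and> represents \<psi> \<sigma> e s" for \<sigma> e s
    by (simp add: represents_def)
  have "determines (F \<union> F') (Conj \<phi> \<psi>)"
    unfolding determines_def mso_sat.simps using det[unfolded determines_def] rep by meson
  then show ?case using F F' by (intro exI[of _ "F \<union> F'"]) auto
next
  case (Ex_elem x \<phi>)
  then obtain F where F: "finite F" "\<forall>D\<in>F. gdec N D" "atoms N \<subseteq> F" "determines F \<phi>" by auto
  have x: "2 * x < N" using Ex_elem.prems by simp
  \<comment> \<open>Even and odd indices never meet, so the update disturbs no other variable of
    either kind.\<close>
  have rep: "represents \<phi> (\<sigma>(2 * x := {a})) (e(x := a)) s" if "represents (Ex_elem x \<phi>) \<sigma> e s" for \<sigma> e s a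
    using that Suc_double_not_eq_double unfolding represents_def by simp
  have "determines (atoms N \<union> moves F (2 * x)) (Ex_elem x \<phi>)"
    unfolding determines_def
  proof (intro allI impI)
    fix G \<gamma> \<gamma>' \<sigma> \<sigma>' e e' s s'
    assume *: "pair_graph G" "edge_gadget \<gamma>" "edge_gadget \<gamma>'" "sim (atoms N \<union> moves F (2 * x)) G \<gamma> \<gamma>' \<sigma> \<sigma>'"
      "represents (Ex_elem x \<phi>) \<sigma> e s" "represents (Ex_elem x \<phi>) \<sigma>' e' s'"
      "mso_sat (edge_gadget_reduction \<gamma> G) e s (Ex_elem x \<phi>)"
    then obtain a where a: "a \<in> pverts (edge_gadget_reduction \<gamma> G)"
      "mso_sat (edge_gadget_reduction \<gamma> G) (e(x := a)) s \<phi>" by auto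
    from a(1) have "{a} \<subseteq> pverts (edge_gadget_reduction \<gamma> G)" by blast
    from sim_response[OF *(4) F(3) x *(1-3) this] obtain X' where
      X': "sim F G \<gamma> \<gamma>' (\<sigma>(2 * x := {a})) (\<sigma>'(2 * x := X'))" by blast
    \<comment> \<open>The answer X' to {a} is known only as a set; agreement on the atoms makes it a
      singleton again.\<close>
    from sim_singleton[OF X' F(3) x *(1-3)] obtain a' where a': "X' = {a'}" by auto
    have "a' \<in> pverts (edge_gadget_reduction \<gamma>' G)" using simD(2)[OF X', of "2 * x"] a' by simp
    moreover have "mso_sat (edge_gadget_reduction \<gamma>' G) (e'(x := a')) s' \<phi>"
      using determines_iff[OF F(4) *(1-3) X'[unfolded a'] rep[OF *(5)] rep[OF *(6)]] a(2) by blast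
    ultimately show "mso_sat (edge_gadget_reduction \<gamma>' G) e' s' (Ex_elem x \<phi>)" by auto
  qed
  moreover have "gdec N M" if "M \<in> moves F (2 * x)" for M
    using gdec_moves[OF F(1) _ x that] F(2) by blast
  ultimately show ?case
    using finite_atoms finite_moves[OF F(1)] gdec_atoms
    by (intro exI[of _ "atoms N \<union> moves F (2 * x)"]) auto
next
  case (Ex_set X \<phi>)
  then obtain F where F: "finite F" "\<forall>D\<in>F. gdec N D" "atoms N \<subseteq> F" "determines F \<phi>" by auto
  have X: "Suc (2 * X) < N" using Ex_set.prems by simp
  have rep: "represents \<phi> (\<sigma>(Suc (2 * X) := A)) e (s(X := A))" if "represents (Ex_set X \<phi>) \<sigma> e s" for \<sigma> e s A
    using that double_not_eq_Suc_double unfolding represents_def by simp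
  have "determines (atoms N \<union> moves F (Suc (2 * X))) (Ex_set X \<phi>)"
    unfolding determines_def
  proof (intro allI impI)
    fix G \<gamma> \<gamma>' \<sigma> \<sigma>' e e' s s'
    assume *: "pair_graph G" "edge_gadget \<gamma>" "edge_gadget \<gamma>'" "sim (atoms N \<union> moves F (Suc (2 * X))) G \<gamma> \<gamma>' \<sigma> \<sigma>'"
      "represents (Ex_set X \<phi>) \<sigma> e s" "represents (Ex_set X \<phi>) \<sigma>' e' s'"
      "mso_sat (edge_gadget_reduction \<gamma> G) e s (Ex_set X \<phi>)"
    then obtain A where A: "A \<subseteq> pverts (edge_gadget_reduction \<gamma> G)"
      "mso_sat (edge_gadget_reduction \<gamma> G) e (s(X := A)) \<phi>" by auto
    from sim_response[OF *(4) F(3) X *(1-3) A(1)] obtain A' where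
      A': "sim F G \<gamma> \<gamma>' (\<sigma>(Suc (2 * X) := A)) (\<sigma>'(Suc (2 * X) := A'))" by blast
    have "A' \<subseteq> pverts (edge_gadget_reduction \<gamma>' G)" using simD(2)[OF A', of "Suc (2 * X)"] by simp
    moreover have "mso_sat (edge_gadget_reduction \<gamma>' G) e' (s'(X := A')) \<phi>"
      using determines_iff[OF F(4) *(1-3) A' rep[OF *(5)] rep[OF *(6)]] A(2) by blast
    ultimately show "mso_sat (edge_gadget_reduction \<gamma>' G) e' s' (Ex_set X \<phi>)" by auto
  qed
  moreover have "gdec N M" if "M \<in> moves F (Suc (2 * X))" for M
    using gdec_moves[OF F(1) _ X that] F(2) by blast
  ultimately show ?case
    using finite_atoms finite_moves[OF F(1)] gdec_atoms
    by (intro exI[of _ "atoms N \<union> moves F (Suc (2 * X))"]) auto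
qed

theorem theorem10:
  fixes P Pstar :: "nat pair_pre_digraph set"
  assumes "isomorphism_closed_class P"
    and "mso_definable Pstar"
  shows "decidable_for gadget_code edge_gadget
           (\<lambda>\<gamma>. is_reduction (edge_gadget_reduction \<gamma>) P Pstar)"
proof -
  obtain \<phi> where \<phi>: "mso_sentence \<phi>" "Pstar = {G. pair_graph G \<and> mso_models G \<phi>}"
    using assms(2) unfolding mso_definable_def by blast
  obtain F where F: "finite F" "\<And>D. D \<in> F \<Longrightarrow> gdec (index_bound \<phi>) D" "determines F \<phi>"
    using ex_determining_family[of \<phi> "index_bound \<phi>"] by auto
  show ?thesis
  proof (rule decidable_for_gadget_pattern[OF F(1,2)])
    fix \<gamma> \<gamma>' assume \<gamma>: "edge_gadget \<gamma>" "edge_gadget \<gamma>'"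
      and agree: "\<And>D. D \<in> F \<Longrightarrow> D \<gamma> (\<lambda>_. {}) \<longleftrightarrow> D \<gamma>' (\<lambda>_. {})"
      and red: "is_reduction (edge_gadget_reduction \<gamma>) P Pstar"
    \<comment> \<open>Whether G is in P does not depend on the gadget, so only the side of
      \<open>Pstar\<close> has to be compared.\<close>
    have "edge_gadget_reduction \<gamma> G \<in> Pstar \<longleftrightarrow> edge_gadget_reduction \<gamma>' G \<in> Pstar"
      if G: "pair_graph G" for G
    proof -
      \<comment> \<open>A sentence has no free variables, so the all-empty family represents every
        assignment. Its traces are empty, and \<open>sim\<close> reduces to agreement on F.\<close>
      have "trace \<delta> G u v {} = {}" for \<delta> u v unfolding trace_def by simp
      then have "sim F G \<gamma> \<gamma>' (\<lambda>_. {}) (\<lambda>_. {})"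
        unfolding sim_def using agree by simp
      moreover have "represents \<phi> (\<lambda>_. {}) e s" for e s
        using \<phi>(1) unfolding represents_def mso_sentence_def by simp
      ultimately have "mso_sat (edge_gadget_reduction \<gamma> G) e s \<phi> \<longleftrightarrow>
          mso_sat (edge_gadget_reduction \<gamma>' G) e s \<phi>" for e s
        using determines_iff[OF F(3) G \<gamma>] by blast
      moreover have "pair_graph (edge_gadget_reduction \<gamma> G)" "pair_graph (edge_gadget_reduction \<gamma>' G)"
        using pair_graph_edge_gadget_reduction \<gamma> G by (metis prod.exhaust)+
      ultimately show ?thesis unfolding \<phi>(2) mso_models_def by simp
    qed
    then show "is_reduction (edge_gadget_reduction \<gamma>') P Pstar"
      using red unfolding is_reduction_def by blast
  qed
qed

end
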